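(* Let $c\in V$ be the weak solution, i.e. $a(c,d)=l(d)$ for all $d\in V$, and let $c_h\in V_h$ be the Galerkin solution, i.e. $a(c_h,d_h)=l(d_h)$ for all $d_h\in V_h$. Put $e=c_h-c$. If the exact solution $c$ has regularity $r\ge p+1$ (i.e. $c\in H^{r}(\Omega)$ with $r\geq p+1$), then $$\|e\|_E\le C'\,h^p\,\|c\|_{p+1},$$ where $C'>0$ is a constant depending only on $p$, $\Omega$, the coefficients $D_x,D_y,u,v,\mu$ and the interpolation constant $\bar C(p,\Omega)$, and not on $h$, $c$ or $q$.
   Context: Let $\Omega\subset\mathbb R^2$ be a bounded domain, $q\in L_2(\Omega)$, and let $D_x,D_y,u,v$ be bounded functions on $\Omega$ with $D_x,D_y$ bounded below by positive constants. Let $\mu>0$ be a constant and let $\overline u=(u,v)$ satisfy $\nabla\cdot\overline u=0$ on $\Omega$. The advection-diffusion-reaction problem is $-\frac{\partial}{\partial x}\left(D_x\frac{\partial c}{\partial x}\right)-\frac{\partial}{\partial y}\left(D_y\frac{\partial c}{\partial y}\right)+\overline u\cdot\nabla c+\mu c=q$ in $\Omega$, $c=0$ on $\partial\Omega$. Set $V=H^1_0(\Omega)$ and $$a(c,d)=\int_\Omega D_x\frac{\partial c}{\partial x}\frac{\partial d}{\partial x}+\int_\Omega D_y\frac{\partial c}{\partial y}\frac{\partial d}{\partial y}+\int_\Omega d\,\overline u\cdot\nabla c+\int_\Omega\mu\,c\,d,\qquad l(d)=\int_\Omega q\,d.$$ The energy norm is $\|d\|_E^2=a(d,d)=\int_\Omega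 D_x\left(\frac{\partial d}{\partial x}\right)^2+\int_\Omega D_y\left(\frac{\partial d}{\partial y}\right)^2+\int_\Omega\mu d^2$ for $d\in V$. Write $\|\cdot\|_m$ for the $H^m(\Omega)$ norm. Finite element space: $\Omega$ is divided into elements $\Omega_k$, $k=1,\dots,n_{el}$, of diameter $h_k$, with $h=\max_k h_k$, and $V_h\subset V$ is a finite-dimensional (finite element) subspace. Let $p\ge1$ be an integer (the polynomial degree of the elements). The standard interpolation estimate is in force: for $w\in V\cap H^{p+1}(\Omega)$ the nodal interpolant $\tilde w_h\in V_h$ satisfies $\|\tilde w_h-w\|_1\le\bar C(p,\Omega)\,h^p\,\|w\|_{p+1}$, with $\bar C(p,\Omega)$ independent of $h$ and $w$. *)

theory Defs
  imports "HOL-Analysis.Analysis"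
begin

text \<open>
  Elements of \<open>L\<^sub>2\<close> and of the Sobolev spaces are represented by functions on the whole plane, of which
  only the values on the domain matter, up to null sets. Integrals are Lebesgue integrals over
  \<open>lebesgue_on \<Omega>\<close>.
\<close>

subsection \<open>Test functions\<close>

definition dx :: "(real \<times> real \<Rightarrow> real) \<Rightarrow> real \<times> real \<Rightarrow> real" where
  "dx f z = deriv (\<lambda>s. f (s, snd z)) (fst z)"

definition dy :: "(real \<times> real \<Rightarrow> real) \<Rightarrow> real \<times> real \<Rightarrow> real" where
  "dy f z = deriv (\<lambda>t. f (fst z, t)) (snd z)"

primrec Ck :: "nat \<Rightarrow> (real \<times> real \<Rightarrow> real) \<Rightarrow> bool" where
  "Ck 0 f \<longleftrightarrow> continuous_on UNIV f"
| "Ck (Suc k) f \<longleftrightarrow> continuous_on UNIV f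
     \<and> (\<forall>x y. (\<lambda>s. f (s, y)) differentiable (at x))
     \<and> (\<forall>x y. (\<lambda>t. f (x, t)) differentiable (at y))
     \<and> Ck k (dx f) \<and> Ck k (dy f)"

definition test_functions :: "(real \<times> real) set \<Rightarrow> (real \<times> real \<Rightarrow> real) set" where
  "test_functions \<Omega> = {\<phi>. (\<forall>k. Ck k \<phi>)
     \<and> compact (closure {z. \<phi> z \<noteq> 0}) \<and> closure {z. \<phi> z \<noteq> 0} \<subseteq> \<Omega>}"

subsection \<open>Lebesgue and Sobolev spaces\<close>

definition L2 :: "(real \<times> real) set \<Rightarrow> (real \<times> real \<Rightarrow> real) set" where
  "L2 \<Omega> = {f. f \<in> borel_measurable (lebesgue_on \<Omega>)
     \<and> integrable (lebesgue_on \<Omega>) (\<lambda>z. (f z)\<^sup>2)}"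

definition loc_integrable :: "(real \<times> real) set \<Rightarrow> (real \<times> real \<Rightarrow> real) \<Rightarrow> bool" where
  "loc_integrable \<Omega> f \<longleftrightarrow> f \<in> borel_measurable (lebesgue_on \<Omega>)
     \<and> (\<forall>K. compact K \<and> K \<subseteq> \<Omega> \<longrightarrow> integrable (lebesgue_on K) f)"

definition is_weak_deriv ::
  "(real \<times> real) set \<Rightarrow> nat \<Rightarrow> nat \<Rightarrow> (real \<times> real \<Rightarrow> real) \<Rightarrow> (real \<times> real \<Rightarrow> real) \<Rightarrow> bool" where
  "is_weak_deriv \<Omega> i j f g \<longleftrightarrow> loc_integrable \<Omega> f \<and> loc_integrable \<Omega> g
     \<and> (\<forall>\<phi>\<in>test_functions \<Omega>.
          (\<integral>z. f z * (dx ^^ i) ((dy ^^ j) \<phi>) z \<partial>lebesgue_on \<Omega>)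
          = (-1) ^ (i + j) * (\<integral>z. g z * \<phi> z \<partial>lebesgue_on \<Omega>))"

text \<open>The weak derivative is determined only up to a null set; a representative is chosen.\<close>

definition weak_deriv ::
  "(real \<times> real) set \<Rightarrow> nat \<Rightarrow> nat \<Rightarrow> (real \<times> real \<Rightarrow> real) \<Rightarrow> real \<times> real \<Rightarrow> real" where
  "weak_deriv \<Omega> i j f = (SOME g. is_weak_deriv \<Omega> i j f g)"

abbreviation wdx :: "(real \<times> real) set \<Rightarrow> (real \<times> real \<Rightarrow> real) \<Rightarrow> real \<times> real \<Rightarrow> real" where
  "wdx \<Omega> \<equiv> weak_deriv \<Omega> 1 0"

abbreviation wdy :: "(real \<times> real) set \<Rightarrow> (real \<times> real \<Rightarrow> real) \<Rightarrow> real \<times> real \<Rightarrow> real" where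
  "wdy \<Omega> \<equiv> weak_deriv \<Omega> 0 1"

definition sobolev :: "(real \<times> real) set \<Rightarrow> nat \<Rightarrow> (real \<times> real \<Rightarrow> real) set" where
  "sobolev \<Omega> m = {f \<in> L2 \<Omega>. \<forall>i j. i + j \<le> m \<longrightarrow> (\<exists>g\<in>L2 \<Omega>. is_weak_deriv \<Omega> i j f g)}"

definition sobolev_norm :: "(real \<times> real) set \<Rightarrow> nat \<Rightarrow> (real \<times> real \<Rightarrow> real) \<Rightarrow> real" where
  "sobolev_norm \<Omega> m f =
     sqrt (\<Sum>(i, j)\<in>{(i, j). i + j \<le> m}. \<integral>z. (weak_deriv \<Omega> i j f z)\<^sup>2 \<partial>lebesgue_on \<Omega>)"

definition sobolev0 :: "(real \<times> real) set \<Rightarrow> (real \<times> real \<Rightarrow> real) set" where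
  "sobolev0 \<Omega> = {f \<in> sobolev \<Omega> 1.
     \<forall>\<epsilon>>0. \<exists>\<phi>\<in>test_functions \<Omega>. sobolev_norm \<Omega> 1 (\<lambda>z. \<phi> z - f z) < \<epsilon>}"

subsection \<open>The advection-diffusion-reaction problem\<close>

definition bounded_domain :: "(real \<times> real) set \<Rightarrow> bool" where
  "bounded_domain \<Omega> \<longleftrightarrow> open \<Omega> \<and> connected \<Omega> \<and> \<Omega> \<noteq> {} \<and> bounded \<Omega>"

definition bounded_coeff :: "(real \<times> real) set \<Rightarrow> (real \<times> real \<Rightarrow> real) \<Rightarrow> bool" where
  "bounded_coeff \<Omega> f \<longleftrightarrow> f \<in> borel_measurable (lebesgue_on \<Omega>) \<and> bounded (f ` \<Omega>)"

definition bounded_below :: "(real \<times> real) set \<Rightarrow> (real \<times> real \<Rightarrow> real) \<Rightarrow> bool" where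
  "bounded_below \<Omega> f \<longleftrightarrow> (\<exists>\<delta>>0. \<forall>z\<in>\<Omega>. \<delta> \<le> f z)"

text \<open>
  The velocity is only bounded, so its divergence is taken in the sense of distributions.
\<close>

definition divergence_free ::
  "(real \<times> real) set \<Rightarrow> (real \<times> real \<Rightarrow> real) \<Rightarrow> (real \<times> real \<Rightarrow> real) \<Rightarrow> bool" where
  "divergence_free \<Omega> u v \<longleftrightarrow>
     (\<forall>\<phi>\<in>test_functions \<Omega>. (\<integral>z. u z * dx \<phi> z + v z * dy \<phi> z \<partial>lebesgue_on \<Omega>) = 0)"

definition adr_form ::
  "(real \<times> real) set \<Rightarrow> (real \<times> real \<Rightarrow> real) \<Rightarrow> (real \<times> real \<Rightarrow> real) \<Rightarrow> (real \<times> real \<Rightarrow> real)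
   \<Rightarrow> (real \<times> real \<Rightarrow> real) \<Rightarrow> real \<Rightarrow> (real \<times> real \<Rightarrow> real) \<Rightarrow> (real \<times> real \<Rightarrow> real) \<Rightarrow> real" where
  "adr_form \<Omega> Dx Dy u v \<mu> c d =
       (\<integral>z. Dx z * wdx \<Omega> c z * wdx \<Omega> d z \<partial>lebesgue_on \<Omega>)
     + (\<integral>z. Dy z * wdy \<Omega> c z * wdy \<Omega> d z \<partial>lebesgue_on \<Omega>)
     + (\<integral>z. d z * (u z * wdx \<Omega> c z + v z * wdy \<Omega> c z) \<partial>lebesgue_on \<Omega>)
     + (\<integral>z. \<mu> * c z * d z \<partial>lebesgue_on \<Omega>)"

definition load :: "(real \<times> real) set \<Rightarrow> (real \<times> real \<Rightarrow> real) \<Rightarrow> (real \<times> real \<Rightarrow> real) \<Rightarrow> real" where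
  "load \<Omega> q d = (\<integral>z. q z * d z \<partial>lebesgue_on \<Omega>)"

definition energy_norm ::
  "(real \<times> real) set \<Rightarrow> (real \<times> real \<Rightarrow> real) \<Rightarrow> (real \<times> real \<Rightarrow> real) \<Rightarrow> (real \<times> real \<Rightarrow> real)
   \<Rightarrow> (real \<times> real \<Rightarrow> real) \<Rightarrow> real \<Rightarrow> (real \<times> real \<Rightarrow> real) \<Rightarrow> real" where
  "energy_norm \<Omega> Dx Dy u v \<mu> d = sqrt (adr_form \<Omega> Dx Dy u v \<mu> d d)"

subsection \<open>Finite element spaces and nodal interpolation\<close>

definition mesh :: "(real \<times> real) set \<Rightarrow> nat \<Rightarrow> (nat \<Rightarrow> (real \<times> real) set) \<Rightarrow> bool" where
  "mesh \<Omega> nel K \<longleftrightarrow> nel \<ge> 1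
     \<and> (\<forall>k\<in>{1..nel}. open (K k) \<and> K k \<noteq> {} \<and> K k \<subseteq> \<Omega>)
     \<and> disjoint_family_on K {1..nel}
     \<and> closure \<Omega> = (\<Union>k\<in>{1..nel}. closure (K k))"

definition mesh_size :: "nat \<Rightarrow> (nat \<Rightarrow> (real \<times> real) set) \<Rightarrow> real" where
  "mesh_size nel K = (MAX k\<in>{1..nel}. diameter (K k))"

definition fin_dim_subspace ::
  "(real \<times> real \<Rightarrow> real) set \<Rightarrow> (real \<times> real \<Rightarrow> real) set \<Rightarrow> bool" where
  "fin_dim_subspace Vh V \<longleftrightarrow> Vh \<subseteq> V
     \<and> (\<exists>(n::nat) \<psi>. Vh = {(\<lambda>z. \<Sum>i<n. a i * \<psi> i z) | a. True})"

text \<open>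
  \<open>\<xi> i\<close> are the nodes not lying on the boundary (where members of \<open>V\<close> vanish) and \<open>\<phi> i\<close> the
  associated shape functions. They need not span \<open>Vh\<close>.
\<close>

definition nodal_shape_functions ::
  "(real \<times> real) set \<Rightarrow> (real \<times> real \<Rightarrow> real) set \<Rightarrow> nat \<Rightarrow> (nat \<Rightarrow> real \<times> real)
   \<Rightarrow> (nat \<Rightarrow> real \<times> real \<Rightarrow> real) \<Rightarrow> bool" where
  "nodal_shape_functions \<Omega> Vh N \<xi> \<phi> \<longleftrightarrow>
     (\<forall>i<N. \<xi> i \<in> \<Omega> \<and> \<phi> i \<in> Vh \<and> continuous_on \<Omega> (\<phi> i))
     \<and> (\<forall>i<N. \<forall>j<N. \<phi> i (\<xi> j) = (if i = j then 1 else 0))"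

text \<open>
  Nodal values are those of the continuous representative, which exists on an open subset of the
  plane for members of \<open>H\<^sup>m\<close> with \<open>m \<ge> 2\<close> and is then unique on that set.
\<close>

definition continuous_rep ::
  "(real \<times> real) set \<Rightarrow> (real \<times> real \<Rightarrow> real) \<Rightarrow> real \<times> real \<Rightarrow> real" where
  "continuous_rep \<Omega> w =
     (SOME w'. continuous_on \<Omega> w' \<and> (AE z in lebesgue_on \<Omega>. w' z = w z))"

definition nodal_interpolant ::
  "(real \<times> real) set \<Rightarrow> nat \<Rightarrow> (nat \<Rightarrow> real \<times> real) \<Rightarrow> (nat \<Rightarrow> real \<times> real \<Rightarrow> real)
   \<Rightarrow> (real \<times> real \<Rightarrow> real) \<Rightarrow> real \<times> real \<Rightarrow> real" where
  "nodal_interpolant \<Omega> N \<xi> \<phi> w = (\<lambda>z. \<Sum>i<N. continuous_rep \<Omega> w (\<xi> i) * \<phi> i z)"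

definition interpolation_estimate ::
  "(real \<times> real) set \<Rightarrow> nat \<Rightarrow> real \<Rightarrow> real \<Rightarrow> nat \<Rightarrow> (nat \<Rightarrow> real \<times> real)
   \<Rightarrow> (nat \<Rightarrow> real \<times> real \<Rightarrow> real) \<Rightarrow> bool" where
  "interpolation_estimate \<Omega> p Cbar h N \<xi> \<phi> \<longleftrightarrow>
     (\<forall>w \<in> sobolev0 \<Omega> \<inter> sobolev \<Omega> (p + 1).
        sobolev_norm \<Omega> 1 (\<lambda>z. nodal_interpolant \<Omega> N \<xi> \<phi> w z - w z)
        \<le> Cbar * h ^ p * sobolev_norm \<Omega> (p + 1) w)"

end

theory Submission
  imports Defs
begin

text \<open>
  Galerkin orthogonality gives \<open>a(e, e) = a(e, w - c)\<close> for \<open>e = c\<^sub>h - c\<close> and the interpolant \<open>w\<close>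
  of \<open>c\<close>. On \<open>H\<^sup>1\<^sub>0\<close> the convection term of \<open>a(e, e)\<close> vanishes: for a test function \<open>\<phi>\<close> it is
  half the integral of \<open>u \<cdot> \<nabla>(\<phi>\<^sup>2)\<close>, which is zero because \<open>u\<close> is divergence free, and the general
  case follows by approximation. So \<open>a\<close> is coercive on \<open>H\<^sup>1\<^sub>0\<close>, and since it is bounded on \<open>H\<^sup>1\<close>, the
  energy of \<open>e\<close> is controlled by the \<open>H\<^sup>1\<close> norm of \<open>w - c\<close>.

  Weak derivatives are chosen representatives, so even their additivity rests on their uniqueness
  almost everywhere. This needs enough test functions: products of \<open>exp(-1/t)\<close> profiles,
  rescaled, converge boundedly to the indicator of any open box, and a function whose
  integral over every box vanishes is zero almost everywhere.
\<close>

subsection \<open>Smooth bump functions\<close>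

text \<open>The obstacle is the velocity: it is merely bounded, and its divergence vanishes only
  against test functions, so integration by parts does not apply directly to an error in
  \<open>sobolev0\<close>. The convection integral is, however, quadratic in value and gradient, and
  replacing \<open>e\<close> by a test function within \<epsilon> in the H1 norm changes it by
  O(\<epsilon>). Coercivity then holds in the full H1 norm, with \<mu> > 0 supplying the
  zeroth-order part. This is what lets Young's inequality bound a(e, w - c) by half of a(e, e) plus
  a multiple of the squared H1 norm of w - c. The multiple is built from a common bound
  \<open>B\<close> of the coefficients and a common lower bound \<alpha> of \<mu>, \<open>Dx\<close>
  and \<open>Dy\<close>; both are fixed before mesh, source and solution, which makes the final
  constant uniform in these. All estimates are made on integrands, almost everywhere, in terms of
  squares of values and weak derivatives, and are integrated once at the end.\<close>

declare Ck.simps(2) [simp del]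

text \<open>The extra power \<open>x ^ k\<close> makes the induction on the polynomial close:
  \<open>pCons a P\<close> splits off the monomial \<open>a * x ^ k\<close> and moves its factor
  \<open>x\<close> into the power.\<close>

lemma poly_times_exp_tendsto_0:
  fixes P :: "real poly"
  shows "((\<lambda>x. x ^ k * poly P x / exp x) \<longlongrightarrow> 0) at_top"
proof (induction P arbitrary: k)
  case 0
  then show ?case by simp
next
  case (pCons a P)
  have "((\<lambda>x::real. a * (x ^ k / exp x) + x ^ Suc k * poly P x / exp x) \<longlongrightarrow> a * 0 + 0) at_top"
    by (intro tendsto_intros tendsto_power_div_exp_0 pCons.IH)
  then show ?case
    by (simp add: algebra_simps add_divide_distrib)
qed

text \<open>The polynomial factor in \<open>1 / t\<close> makes the family closed under
  differentiation, so smoothness of the classical profile \<open>flat 1\<close> follows by induction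
  on the order with \<open>P\<close> arbitrary.\<close>

definition flat :: "real poly \<Rightarrow> real \<Rightarrow> real" where
  "flat P t = (if t > 0 then poly P (1 / t) * exp (- 1 / t) else 0)"

lemma flat_tendsto_0: "(flat P \<longlongrightarrow> 0) (at 0)"
proof -
  have "((\<lambda>x. poly P x / exp x) \<longlongrightarrow> 0) at_top"
    using poly_times_exp_tendsto_0[of 0 P] by simp
  then have "((\<lambda>t. poly P (inverse t) / exp (inverse t)) \<longlongrightarrow> 0) (at_right 0)"
    by (rule filterlim_compose) (rule filterlim_inverse_at_top_right)
  moreover have "\<forall>\<^sub>F t in at_right 0. poly P (inverse t) / exp (inverse t) = flat P t"
    using eventually_at_right_less[of 0]
    by eventually_elim (auto simp: flat_def exp_minus field_simps)
  ultimately have "(flat P \<longlongrightarrow> 0) (at_right 0)"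
    by (rule Lim_transform_eventually)
  moreover have "(flat P \<longlongrightarrow> 0) (at_left 0)"
    by (rule Lim_transform_eventually[OF tendsto_const])
      (auto simp: flat_def eventually_at_filter)
  ultimately show ?thesis
    by (simp add: filterlim_split_at)
qed

text \<open>With x = 1/t, the derivative of P(x) exp(-x) in t is x^2 (P(x) - P'(x)) exp(-x); the two
  \<open>pCons 0\<close> are the factor x^2.\<close>

definition flat_deriv :: "real poly \<Rightarrow> real poly" where
  "flat_deriv P = pCons 0 (pCons 0 (P - pderiv P))"

lemma flat_has_derivative: "(flat P has_real_derivative flat (flat_deriv P) t) (at t)"
proof -
  consider "t > 0" | "t < 0" | "t = 0" by linarith
  then show ?thesis
  proof cases
    case 1
    have "((\<lambda>t. poly P (1 / t) * exp (- 1 / t)) has_real_derivative flat (flat_deriv P) t) (at t)"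
      using 1
      by (auto intro!: derivative_eq_intros simp: flat_def flat_deriv_def field_simps power2_eq_square)
    then show ?thesis
      by (rule DERIV_cong_ev[THEN iffD1, rotated -1, OF _ refl _ refl])
        (use eventually_nhds_in_open[of "{0<..}" t] 1 in
          \<open>auto simp: flat_def elim!: eventually_mono\<close>)
  next
    case 2
    have "((\<lambda>t. 0) has_real_derivative flat (flat_deriv P) t) (at t)"
      using 2 by (auto simp: flat_def)
    then show ?thesis
      by (rule DERIV_cong_ev[THEN iffD1, rotated -1, OF _ refl _ refl])
        (use eventually_nhds_in_open[of "{..<0}" t] 2 in
          \<open>auto simp: flat_def elim!: eventually_mono\<close>)
  next
    case 3
    \<comment> \<open>Dividing by \<open>h\<close> multiplies the polynomial in \<open>1 / h\<close>
      by its variable, so the difference quotient at 0 stays in the family and its limit is already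
      known.\<close>
    have "flat (pCons 0 P) = (\<lambda>h. (flat P (0 + h) - flat P 0) / h)"
      by (auto simp: flat_def)
    moreover have "flat (flat_deriv P) 0 = 0"
      by (simp add: flat_def)
    ultimately show ?thesis
      using flat_tendsto_0[of "pCons 0 P"] 3 unfolding DERIV_def by simp
  qed
qed

lemma continuous_flat: "continuous_on UNIV (flat P)"
  using flat_has_derivative DERIV_continuous_on by blast

text \<open>The inner derivative \<open>a\<close> is absorbed into the polynomial, so that the
  induction hypothesis for \<open>Ck\<close> applies to the result unchanged.\<close>

lemma flat_affine_has_derivative:
  "((\<lambda>s. flat P (a * s + b)) has_real_derivative flat (smult a (flat_deriv P)) (a * s + b)) (at s)"
proof -
  have "((\<lambda>s. flat P (a * s + b)) has_real_derivative flat (flat_deriv P) (a * s + b) * a) (at s)"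
    by (rule DERIV_chain2[OF flat_has_derivative]) (auto intro!: derivative_eq_intros)
  moreover have "flat (flat_deriv P) (a * s + b) * a = flat (smult a (flat_deriv P)) (a * s + b)"
    by (simp add: flat_def)
  ultimately show ?thesis by simp
qed

section \<open>Calculus of the classes \<open>Ck\<close>\<close>

lemma dx_eqI: "((\<lambda>s. f (s, y)) has_real_derivative D) (at x) \<Longrightarrow> dx f (x, y) = D"
  by (simp add: dx_def DERIV_imp_deriv)

lemma dy_eqI: "((\<lambda>t. f (x, t)) has_real_derivative D) (at y) \<Longrightarrow> dy f (x, y) = D"
  by (simp add: dy_def DERIV_imp_deriv)

text \<open>\<open>dx\<close> and \<open>dy\<close> are built on \<open>deriv\<close>; supplying
  actual partial derivatives \<open>fx\<close> and \<open>fy\<close> identifies them, so that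
  inductions on the order need no computation with \<open>deriv\<close>.\<close>

lemma Ck_SucI:
  assumes "continuous_on UNIV f"
    and "\<And>x y. ((\<lambda>s. f (s, y)) has_real_derivative fx (x, y)) (at x)"
    and "\<And>x y. ((\<lambda>t. f (x, t)) has_real_derivative fy (x, y)) (at y)"
    and "Ck k fx" and "Ck k fy"
  shows "Ck (Suc k) f"
proof -
  have *: "dx f = fx" "dy f = fy"
    using assms by (auto simp: fun_eq_iff intro!: dx_eqI dy_eqI)
  show ?thesis
    unfolding Ck.simps real_differentiable_def * using assms by blast
qed

lemma Ck_imp_continuous: "Ck k f \<Longrightarrow> continuous_on UNIV f"
  by (cases k) (auto simp: Ck.simps(2))

lemma Ck_Suc_dx:
  "Ck (Suc k) f \<Longrightarrow> ((\<lambda>s. f (s, y)) has_real_derivative dx f (x, y)) (at x)"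
  by (simp add: Ck.simps(2) dx_def DERIV_deriv_iff_real_differentiable)

lemma Ck_Suc_dy:
  "Ck (Suc k) f \<Longrightarrow> ((\<lambda>t. f (x, t)) has_real_derivative dy f (x, y)) (at y)"
  by (simp add: Ck.simps(2) dy_def DERIV_deriv_iff_real_differentiable)

lemma Ck_dx: "Ck (Suc k) f \<Longrightarrow> Ck k (dx f)"
  by (simp add: Ck.simps(2))

lemma Ck_dy: "Ck (Suc k) f \<Longrightarrow> Ck k (dy f)"
  by (simp add: Ck.simps(2))

text \<open>The recursion of \<open>Ck\<close> passes to partial derivatives, so this takes an
  induction. It serves the product rule, in which the undifferentiated factors reappear and must be
  of the lower class.\<close>

lemma Ck_antimono: "Ck (Suc k) f \<Longrightarrow> Ck k f"
proof (induction k arbitrary: f)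
  case (Suc k)
  note f = Suc.prems
  show ?case
    by (rule Ck_SucI[OF Ck_imp_continuous[OF f] Ck_Suc_dx[OF f] Ck_Suc_dy[OF f]
          Suc.IH[OF Ck_dx[OF f]] Suc.IH[OF Ck_dy[OF f]]])
qed (simp add: Ck.simps(2))

lemma Ck_zero: "Ck k (\<lambda>_. 0)"
proof (induction k)
  case (Suc k)
  show ?case
    by (rule Ck_SucI[where fx = "\<lambda>_. 0" and fy = "\<lambda>_. 0"]) (auto intro: Suc)
qed simp

lemma Ck_add: "Ck k f \<Longrightarrow> Ck k g \<Longrightarrow> Ck k (\<lambda>z. f z + g z)"
proof (induction k arbitrary: f g)
  case 0
  then show ?case by (auto intro: continuous_intros)
next
  case (Suc k)
  note f = Suc.prems(1) and g = Suc.prems(2)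
  show ?case
    by (rule Ck_SucI[OF continuous_on_add[OF Ck_imp_continuous[OF f] Ck_imp_continuous[OF g]]
          DERIV_add[OF Ck_Suc_dx[OF f] Ck_Suc_dx[OF g]] DERIV_add[OF Ck_Suc_dy[OF f] Ck_Suc_dy[OF g]]
          Suc.IH[OF Ck_dx[OF f] Ck_dx[OF g]] Suc.IH[OF Ck_dy[OF f] Ck_dy[OF g]]])
qed

lemma Ck_diff: "Ck k f \<Longrightarrow> Ck k g \<Longrightarrow> Ck k (\<lambda>z. f z - g z)"
proof (induction k arbitrary: f g)
  case 0
  then show ?case by (auto intro: continuous_intros)
next
  case (Suc k)
  note f = Suc.prems(1) and g = Suc.prems(2)
  show ?case
    by (rule Ck_SucI[OF continuous_on_diff[OF Ck_imp_continuous[OF f] Ck_imp_continuous[OF g]]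
          DERIV_diff[OF Ck_Suc_dx[OF f] Ck_Suc_dx[OF g]] DERIV_diff[OF Ck_Suc_dy[OF f] Ck_Suc_dy[OF g]]
          Suc.IH[OF Ck_dx[OF f] Ck_dx[OF g]] Suc.IH[OF Ck_dy[OF f] Ck_dy[OF g]]])
qed

lemma has_derivative_product_dx:
  assumes "Ck (Suc k) f" "Ck (Suc k) g"
  shows "((\<lambda>s. f (s, y) * g (s, y)) has_real_derivative dx f (x, y) * g (x, y) + f (x, y) * dx g (x, y))
    (at x)"
  using DERIV_mult[OF Ck_Suc_dx[OF assms(1)] Ck_Suc_dx[OF assms(2)]] by (simp only: add.commute mult.commute)

lemma has_derivative_product_dy:
  assumes "Ck (Suc k) f" "Ck (Suc k) g"
  shows "((\<lambda>t. f (x, t) * g (x, t)) has_real_derivative dy f (x, y) * g (x, y) + f (x, y) * dy g (x, y))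
    (at y)"
  using DERIV_mult[OF Ck_Suc_dy[OF assms(1)] Ck_Suc_dy[OF assms(2)]] by (simp only: add.commute mult.commute)

lemma Ck_mult: "Ck k f \<Longrightarrow> Ck k g \<Longrightarrow> Ck k (\<lambda>z. f z * g z)"
proof (induction k arbitrary: f g)
  case 0
  then show ?case by (auto intro: continuous_intros)
next
  case (Suc k)
  note f = Suc.prems(1) and g = Suc.prems(2)
  have "Ck k (\<lambda>z. dx f z * g z + f z * dx g z)" "Ck k (\<lambda>z. dy f z * g z + f z * dy g z)"
    by (rule f g Ck_add Suc.IH Ck_dx Ck_dy Ck_antimono)+
  then show ?case
    by (rule Ck_SucI[OF continuous_on_mult[OF Ck_imp_continuous[OF f] Ck_imp_continuous[OF g]]
          has_derivative_product_dx[OF f g] has_derivative_product_dy[OF f g]])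
qed

lemma dx_mult:
  assumes "Ck (Suc k) f" "Ck (Suc k) g"
  shows "dx (\<lambda>z. f z * g z) z = dx f z * g z + f z * dx g z"
  by (cases z) (simp only: dx_eqI[OF has_derivative_product_dx[OF assms]])

lemma dy_mult:
  assumes "Ck (Suc k) f" "Ck (Suc k) g"
  shows "dy (\<lambda>z. f z * g z) z = dy f z * g z + f z * dy g z"
  by (cases z) (simp only: dy_eqI[OF has_derivative_product_dy[OF assms]])

section \<open>Bump functions on boxes\<close>

lemma Ck_flat_fst: "Ck k (\<lambda>z. flat P (a * fst z + b))"
proof (induction k arbitrary: P)
  case 0
  then show ?case
    by (auto intro!: continuous_on_compose2[OF continuous_flat] continuous_intros)
next
  case (Suc k)
  show ?case
    by (rule Ck_SucI[where fx = "\<lambda>z. flat (smult a (flat_deriv P)) (a * fst z + b)" and fy = "\<lambda>_. 0"])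
      (auto intro!: continuous_on_compose2[OF continuous_flat] continuous_intros Suc
        flat_affine_has_derivative Ck_zero)
qed

lemma Ck_flat_snd: "Ck k (\<lambda>z. flat P (a * snd z + b))"
proof (induction k arbitrary: P)
  case 0
  then show ?case
    by (auto intro!: continuous_on_compose2[OF continuous_flat] continuous_intros)
next
  case (Suc k)
  show ?case
    by (rule Ck_SucI[where fy = "\<lambda>z. flat (smult a (flat_deriv P)) (a * snd z + b)" and fx = "\<lambda>_. 0"])
      (auto intro!: continuous_on_compose2[OF continuous_flat] continuous_intros Suc
        flat_affine_has_derivative Ck_zero)
qed

text \<open>One profile for each side of the box. The factor \<open>n\<close> only steepens them: it
  leaves the set where the product is nonzero alone and drives the values inside towards 1.\<close>

definition bump :: "real \<Rightarrow> real \<times> real \<Rightarrow> real \<times> real \<Rightarrow> real \<times> real \<Rightarrow> real" where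
  "bump n a b z =
     flat 1 (n * fst z + - (n * fst a)) * flat 1 (- n * fst z + n * fst b)
     * (flat 1 (n * snd z + - (n * snd a)) * flat 1 (- n * snd z + n * snd b))"

lemma Ck_bump: "Ck k (bump n a b)"
  unfolding bump_def by (intro Ck_mult Ck_flat_fst Ck_flat_snd)

lemma flat_one_eq_0_iff: "flat 1 t = 0 \<longleftrightarrow> t \<le> 0"
  by (auto simp: flat_def)

lemma abs_flat_one_le: "\<bar>flat 1 t\<bar> \<le> 1"
  by (auto simp: flat_def)

lemma mem_box_plane: "z \<in> box a b \<longleftrightarrow>
    fst a < fst z \<and> fst z < fst b \<and> snd a < snd z \<and> snd z < snd b" for z :: "real \<times> real"
  by (auto simp: mem_box Basis_prod_def inner_prod_def ball_Un)

lemma bump_nonzero_iff: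
  assumes "n > 0"
  shows "bump n a b z \<noteq> 0 \<longleftrightarrow> z \<in> box a b"
  using assms by (auto simp: bump_def flat_one_eq_0_iff mem_box_plane not_le
    mult_less_cancel_left_pos)

lemma bump_le_indicator:
  assumes "n > 0"
  shows "\<bar>bump n a b z\<bar> \<le> indicator (box a b) z"
proof (cases "z \<in> box a b")
  case True
  have "\<bar>bump n a b z\<bar> \<le> 1"
    unfolding bump_def
    by (auto simp: abs_mult intro!: mult_le_one abs_flat_one_le)
  with True show ?thesis by simp
next
  case False
  then have "bump n a b z = 0" using bump_nonzero_iff[OF assms, of a b z] by blast
  then show ?thesis by simp
qed

lemma flat_one_scaled_tendsto:
  assumes "t > 0"
  shows "(\<lambda>n. flat 1 (real (Suc n) * t)) \<longlonglongrightarrow> 1"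
proof -
  have "(\<lambda>n. exp (- (inverse (real (Suc n)) * inverse t))) \<longlonglongrightarrow> exp (- (0 * inverse t))"
    by (intro tendsto_intros LIMSEQ_inverse_real_of_nat)
  moreover have "flat 1 (real (Suc n) * t) = exp (- (inverse (real (Suc n)) * inverse t))" for n
  proof -
    have "real (Suc n) * t > 0" using assms by simp
    then show ?thesis by (simp add: flat_def divide_inverse inverse_mult_distrib del: of_nat_Suc)
  qed
  ultimately show ?thesis by simp
qed

text \<open>Inside the box each profile is exp(-1/(n t)) with a fixed t > 0 and tends to 1; outside,
  every member of the sequence is 0. The shift to \<open>Suc n\<close> keeps the scale
  positive.\<close>

lemma bump_tendsto_indicator: "(\<lambda>n. bump (real (Suc n)) a b z) \<longlonglongrightarrow> indicator (box a b) z"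
proof (cases "z \<in> box a b")
  case True
  have "(\<lambda>n. bump (real (Suc n)) a b z) = (\<lambda>n.
      flat 1 (real (Suc n) * (fst z - fst a)) * flat 1 (real (Suc n) * (fst b - fst z))
      * (flat 1 (real (Suc n) * (snd z - snd a)) * flat 1 (real (Suc n) * (snd b - snd z))))"
    unfolding bump_def by (intro ext arg_cong2[where f = "(*)"] arg_cong[where f = "flat 1"])
      (auto simp: algebra_simps)
  moreover have "\<dots> \<longlonglongrightarrow> 1 * 1 * (1 * 1)"
    using True by (intro tendsto_intros flat_one_scaled_tendsto) (auto simp: mem_box_plane)
  ultimately show ?thesis using True by simp
next
  case False
  then have "bump (real (Suc n)) a b z = 0" for n
    using bump_nonzero_iff[of "real (Suc n)" a b z] by auto
  then show ?thesis using False by simp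
qed

lemma closure_box_subset_cbox: "closure (box a b) \<subseteq> cbox a b" for a :: "'a::euclidean_space"
  by (rule closure_minimal) (use box_subset_cbox in auto)

lemma bump_test_function:
  assumes "n > 0" "cbox a b \<subseteq> \<Omega>"
  shows "bump n a b \<in> test_functions \<Omega>"
  using assms closure_box_subset_cbox[of a b] bounded_box[of a b]
  by (auto simp: test_functions_def Ck_bump bump_nonzero_iff)

subsection \<open>The fundamental lemma of the calculus of variations\<close>

text \<open>Open boxes form an intersection-stable generator of the Borel sets, so induction over
  disjoint unions and complements extends vanishing to the integral over every Borel set, and then
  the density itself is zero.\<close>

lemma AE_eq_0_if_box_integrals_eq_0:
  fixes g :: "'a::euclidean_space \<Rightarrow> real"
  assumes int: "integrable lborel g"
    and box: "\<And>a b. (\<integral>x. indicator (box a b) x * g x \<partial>lborel) = 0"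
  shows "AE x in lborel. g x = 0"
proof (rule sigma_finite_measure.density_zero[OF sigma_finite_lborel int])
  let ?E = "range (\<lambda>(a, b). box a b :: 'a set)"
  have si: "set_integrable lborel A g" if "A \<in> sets lborel" for A
    unfolding set_integrable_def using that int by (rule integrable_mult_indicator)
  have boxes: "set_lebesgue_integral lborel (box a b) g = 0" for a b
    using box[of a b] by (simp add: set_lebesgue_integral_def)
  \<comment> \<open>The complement case needs the integral over the whole space, which is not itself
    a box; it is the limit along growing centred boxes.\<close>
  have univ: "integral\<^sup>L lborel g = 0"
  proof -
    let ?B = "\<lambda>i::nat. box (- (real i *\<^sub>R One)) (real i *\<^sub>R One) :: 'a set"
    have "(\<lambda>i. set_lebesgue_integral lborel (?B i) g)
        \<longlonglongrightarrow> set_lebesgue_integral lborel (\<Union>i. ?B i) g"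
    proof (rule set_integral_cont_up)
      show "incseq ?B"
      proof (rule incseq_SucI, rule subsetI)
        fix i x assume "x \<in> ?B i"
        then have "- real i < x \<bullet> b \<and> x \<bullet> b < real i" if "b \<in> Basis" for b
          using that by (simp add: mem_box)
        then have "- real (Suc i) < x \<bullet> b \<and> x \<bullet> b < real (Suc i)" if "b \<in> Basis" for b
          using that by force
        then show "x \<in> ?B (Suc i)"
          by (simp add: mem_box del: of_nat_Suc)
      qed
      show "set_integrable lborel (\<Union>i. ?B i) g"
        by (rule si) auto
    qed auto
    then show ?thesis
      by (simp add: box UN_box_eq_UNIV set_lebesgue_integral_def LIMSEQ_const_iff)
  qed
  fix A :: "'a set" assume "A \<in> sets lborel"
  then have A: "A \<in> sigma_sets UNIV ?E"
    by (simp add: borel_eq_box sets_measure_of)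
  have "Int_stable ?E"
    by (auto simp: Int_stable_def box_Int_box)
  moreover have "?E \<subseteq> Pow UNIV"
    by simp
  ultimately show "set_lebesgue_integral lborel A g = 0"
    using A
  proof (induct rule: sigma_sets_induct_disjoint)
    case (basic A)
    then show ?case by (auto simp: boxes)
  next
    case empty
    then show ?case by (simp add: set_lebesgue_integral_def)
  next
    case (compl A)
    then have A: "A \<in> sets lborel"
      by (simp add: borel_eq_box sets_measure_of)
    have "set_lebesgue_integral lborel (UNIV - A) g
      = (\<integral>x. g x - indicator A x *\<^sub>R g x \<partial>lborel)"
      unfolding set_lebesgue_integral_def
      by (intro Bochner_Integration.integral_cong) (auto simp: indicator_def)
    also have "\<dots> = 0"
      using compl(2) si[OF A] int univ
      by (simp add: set_lebesgue_integral_def set_integrable_def)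
    finally show ?case .
  next
    case (union A)
    have A: "A i \<in> sets lborel" for i
      using range_subsetD[OF union(2)] by (simp add: borel_eq_box sets_measure_of)
    have "set_lebesgue_integral lborel (\<Union>i. A i) g = (\<Sum>i. set_lebesgue_integral lborel (A i) g)"
      using A union(1)
      by (intro lebesgue_integral_countable_add si) (auto simp: disjoint_family_on_def)
    then show ?case using union(3) by simp
  qed
qed

text \<open>A Lebesgue measurable \<open>g\<close> agrees almost everywhere with a Borel function
  \<open>g'\<close>, whose integrals with respect to \<open>lebesgue\<close> and
  \<open>lborel\<close> coincide.\<close>

lemma AE_lebesgue_eq_0_if_box_integrals_eq_0:
  fixes g :: "'a::euclidean_space \<Rightarrow> real"
  assumes int: "integrable lebesgue g"
    and box: "\<And>a b. (\<integral>x. indicator (box a b) x * g x \<partial>lebesgue) = 0"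
  shows "AE x in lebesgue. g x = 0"
proof -
  obtain g' where g': "g' \<in> borel_measurable lborel" "AE x in lborel. g x = g' x"
    using completion_ex_borel_measurable_real[OF borel_measurable_integrable[OF int]] by auto
  have AE: "AE x in lebesgue. g x = g' x"
    using g'(2) by (rule AE_completion)
  have g'_leb: "g' \<in> borel_measurable lebesgue"
    using g'(1) by (rule measurable_completion)
  have "integrable lebesgue g'"
    by (rule integrable_cong_AE_imp[OF int g'_leb]) (use AE in \<open>eventually_elim, simp\<close>)
  then have int': "integrable lborel g'"
    using integrable_completion[of g' lborel] g'(1) by simp
  have "(\<integral>x. indicator (box a b) x * g' x \<partial>lborel) = 0" for a b
  proof -
    have ind: "indicat_real (box a b) \<in> borel_measurable lebesgue"
      by (intro borel_measurable_indicator sets_completionI_sets) simp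
    have "(\<integral>x. indicator (box a b) x * g' x \<partial>lborel) = (\<integral>x. indicator (box a b) x * g' x \<partial>lebesgue)"
      by (rule integral_completion[symmetric], rule borel_measurable_times[OF _ g'(1)]) simp
    also have "\<dots> = (\<integral>x. indicator (box a b) x * g x \<partial>lebesgue)"
    proof (rule integral_cong_AE)
      show "AE x in lebesgue. indicator (box a b) x * g' x = indicator (box a b) x * g x"
        using AE by eventually_elim simp
    qed (intro borel_measurable_times ind g'_leb borel_measurable_integrable[OF int])+
    finally show ?thesis using box by simp
  qed
  from AE_completion[OF AE_eq_0_if_box_integrals_eq_0[OF int' this]] AE show ?thesis
    by eventually_elim simp
qed

section \<open>Locally integrable functions against compactly supported ones\<close>

lemma integrable_indicator_loc_integrable:
  assumes "loc_integrable \<Omega> f" "compact K" "K \<subseteq> \<Omega>"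
  shows "integrable lebesgue (\<lambda>z. indicator K z * f z)"
proof -
  have "integrable (lebesgue_on K) f"
    using assms by (auto simp: loc_integrable_def)
  then show ?thesis
    using lmeasurable_compact[OF assms(2)] by (simp add: integrable_restrict_space fmeasurableD)
qed

lemma integrable_lebesgue_on_indicator_loc_integrable:
  assumes "loc_integrable \<Omega> f" "compact K" "K \<subseteq> \<Omega>" "\<Omega> \<in> sets lebesgue"
  shows "integrable (lebesgue_on \<Omega>) (\<lambda>z. indicator K z * f z)"
proof -
  have "(\<lambda>z. indicator \<Omega> z *\<^sub>R (indicator K z * f z)) = (\<lambda>z. indicator K z * f z)"
    using assms(3) by (intro ext) (auto simp: indicator_def)
  then show ?thesis
    using assms(4) integrable_indicator_loc_integrable[OF assms(1-3)]
    by (subst integrable_restrict_space) auto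
qed

lemma integrable_loc_integrable_mult:
  assumes f: "loc_integrable \<Omega> f" and K: "compact K" "K \<subseteq> \<Omega>" and \<Omega>: "\<Omega> \<in> sets lebesgue"
    and \<phi>: "continuous_on UNIV \<phi>" "\<And>z. z \<notin> K \<Longrightarrow> \<phi> z = 0"
  shows "integrable (lebesgue_on \<Omega>) (\<lambda>z. f z * \<phi> z)"
proof -
  have "bounded (\<phi> ` K)"
    by (rule compact_imp_bounded[OF compact_continuous_image[OF continuous_on_subset[OF \<phi>(1) subset_UNIV] K(1)]])
  then obtain C where "\<forall>x\<in>\<phi> ` K. norm x \<le> C"
    unfolding bounded_iff by blast
  then have C: "\<bar>\<phi> z\<bar> \<le> C" if "z \<in> K" for z
    using that by simp
  have "\<phi> \<in> borel_measurable (lebesgue_on \<Omega>)"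
    using continuous_on_subset[OF \<phi>(1) subset_UNIV] \<Omega>
    by (rule continuous_imp_measurable_on_sets_lebesgue)
  then have m: "(\<lambda>z. f z * \<phi> z) \<in> borel_measurable (lebesgue_on \<Omega>)"
    using f by (intro borel_measurable_times) (simp_all add: loc_integrable_def)
  have "integrable (lebesgue_on \<Omega>) (\<lambda>z. C * (indicator K z * f z))"
    by (intro integrable_mult_right integrable_lebesgue_on_indicator_loc_integrable[OF f K \<Omega>])
  then show ?thesis
  proof (rule Bochner_Integration.integrable_bound[OF _ m], intro AE_I2)
    fix z
    show "norm (f z * \<phi> z) \<le> norm (C * (indicator K z * f z))"
    proof (cases "z \<in> K")
      case True
      have "\<bar>f z\<bar> * \<bar>\<phi> z\<bar> \<le> \<bar>f z\<bar> * \<bar>C\<bar>"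
        using C[OF True] by (intro mult_left_mono) auto
      then show ?thesis using True by (simp add: abs_mult mult.commute)
    qed (simp add: \<phi>(2))
  qed
qed

text \<open>Bumps give vanishing integrals over boxes whose closure lies in \<Omega>. The global box
  criterion is then applied to \<open>f\<close> cut off to one such box, and countably many boxes
  cover \<Omega>.\<close>

lemma loc_integrable_AE_eq_0:
  assumes "open \<Omega>" and f: "loc_integrable \<Omega> f"
    and test: "\<And>\<phi>. \<phi> \<in> test_functions \<Omega> \<Longrightarrow> (\<integral>z. f z * \<phi> z \<partial>lebesgue_on \<Omega>) = 0"
  shows "AE z in lebesgue_on \<Omega>. f z = 0"
proof -
  have \<Omega>: "\<Omega> \<in> sets lebesgue"
    using \<open>open \<Omega>\<close> by auto
  have fm[measurable]: "f \<in> borel_measurable (lebesgue_on \<Omega>)"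
    using f by (simp add: loc_integrable_def)
  \<comment> \<open>Dominated convergence along the bumps. The closed box supplies the majorant,
    because local integrability only speaks about compact sets.\<close>
  have box0: "(\<integral>z. indicator (box a b) z * f z \<partial>lebesgue) = 0" if ab: "cbox a b \<subseteq> \<Omega>" for a b
  proof -
    let ?w = "\<lambda>z. indicator (cbox a b) z * \<bar>f z\<bar>"
    have w: "integrable (lebesgue_on \<Omega>) ?w"
      using integrable_abs[OF integrable_lebesgue_on_indicator_loc_integrable[OF f _ ab \<Omega>]]
      by (simp add: abs_mult)
    have bump_m: "bump n a b \<in> borel_measurable (lebesgue_on \<Omega>)" for n
      using continuous_on_subset[OF Ck_imp_continuous[OF Ck_bump] subset_UNIV] \<Omega>
      by (rule continuous_imp_measurable_on_sets_lebesgue)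
    have ind_m: "indicator (box a b) \<in> borel_measurable (lebesgue_on \<Omega>)"
      by (intro measurable_restrict_space1 borel_measurable_indicator sets_completionI_sets) simp
    have "(\<lambda>n. \<integral>z. f z * bump (real (Suc n)) a b z \<partial>lebesgue_on \<Omega>)
        \<longlonglongrightarrow> (\<integral>z. f z * indicator (box a b) z \<partial>lebesgue_on \<Omega>)"
    proof (rule integral_dominated_convergence[OF _ _ w])
      show "AE z in lebesgue_on \<Omega>. (\<lambda>n. f z * bump (real (Suc n)) a b z)
          \<longlonglongrightarrow> f z * indicator (box a b) z"
        by (intro AE_I2 tendsto_intros bump_tendsto_indicator)
      fix n
      show "AE z in lebesgue_on \<Omega>. norm (f z * bump (real (Suc n)) a b z) \<le> ?w z"
      proof (intro AE_I2)
        fix z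
        have "indicat_real (box a b) z \<le> indicator (cbox a b) z"
          by (rule indicator_leI) (rule subsetD[OF box_subset_cbox])
        then have "\<bar>bump (real (Suc n)) a b z\<bar> \<le> indicator (cbox a b) z"
          by (rule order_trans[OF bump_le_indicator[of "real (Suc n)"], rotated]) simp
        then show "norm (f z * bump (real (Suc n)) a b z) \<le> ?w z"
          using mult_left_mono[of "\<bar>bump (real (Suc n)) a b z\<bar>" "indicator (cbox a b) z" "\<bar>f z\<bar>"]
          by (simp add: abs_mult mult.commute)
      qed
    qed (use bump_m ind_m in measurable)
    moreover have "(\<integral>z. f z * bump (real (Suc n)) a b z \<partial>lebesgue_on \<Omega>) = 0" for n
      using bump_test_function[OF _ ab] by (intro test) auto
    ultimately have "(\<integral>z. f z * indicator (box a b) z \<partial>lebesgue_on \<Omega>) = 0"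
      by (simp add: LIMSEQ_const_iff)
    moreover have "(\<lambda>z. indicator \<Omega> z *\<^sub>R (f z * indicator (box a b) z)) = (\<lambda>z. indicator (box a b) z * f z)"
      using ab box_subset_cbox[of a b] by (intro ext) (auto simp: indicator_def)
    ultimately show ?thesis
      using \<Omega> by (simp add: integral_restrict_space)
  qed
  have cbox0: "AE z in lebesgue. z \<in> cbox c d \<longrightarrow> f z = 0" if cd: "cbox c d \<subseteq> \<Omega>" for c d
  proof -
    have "integrable lebesgue (\<lambda>z. indicator (box c d) z * (indicator (cbox c d) z * f z))"
      using integrable_mult_indicator[OF _ integrable_indicator_loc_integrable[OF f _ cd], of "box c d"]
      by simp
    also have "(\<lambda>z. indicator (box c d) z * (indicator (cbox c d) z * f z)) = (\<lambda>z. indicator (box c d) z * f z)"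
      using box_subset_cbox[of c d] by (intro ext) (auto simp: indicator_def)
    finally have "AE z in lebesgue. indicator (box c d) z * f z = 0"
    proof (rule AE_lebesgue_eq_0_if_box_integrals_eq_0)
      fix a b :: "real \<times> real"
      \<comment> \<open>An arbitrary test box meets the cut-off box in a box. The same corners serve
        the open and the closed intersection, so the closed one still lies in \<Omega> and
        \<open>box0\<close> applies.\<close>
      obtain a' b' where ab': "box a b \<inter> box c d = box a' b'" "cbox a b \<inter> cbox c d = cbox a' b'"
        by (rule that[OF box_Int_box Int_interval])
      have eq: "(\<lambda>z. indicator (box a b) z * (indicator (box c d) z * f z)) = (\<lambda>z. indicator (box a' b') z * f z)"
        by (simp add: ab'(1)[symmetric] indicator_inter_arith mult.assoc)
      have "cbox a' b' \<subseteq> \<Omega>"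
        using cd unfolding ab'(2)[symmetric] by blast
      then show "(\<integral>z. indicator (box a b) z * (indicator (box c d) z * f z) \<partial>lebesgue) = 0"
        unfolding eq by (rule box0)
    qed
    moreover have "AE z in lebesgue. z \<notin> cbox c d - box c d"
      using negligible_frontier_interval[of c d] unfolding negligible_iff_null_sets by (rule AE_not_in)
    ultimately show ?thesis
    proof eventually_elim
      case (elim z)
      then show ?case by (cases "z \<in> box c d") auto
    qed
  qed
  \<comment> \<open>Countability of the cover allows the exceptional null sets of the boxes to be
    united.\<close>
  obtain \<D> where \<D>: "countable \<D>" "\<D> \<subseteq> Pow \<Omega>" "\<And>X. X \<in> \<D> \<Longrightarrow> \<exists>a b. X = cbox a b" "\<Union>\<D> = \<Omega>"
    by (rule open_countable_Union_open_cbox[OF \<open>open \<Omega>\<close>]) (rule that)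
  have "AE z in lebesgue. \<forall>X\<in>\<D>. z \<in> X \<longrightarrow> f z = 0"
    unfolding AE_ball_countable[OF \<D>(1)]
  proof
    fix X assume "X \<in> \<D>"
    then obtain c d where "X = cbox c d" "cbox c d \<subseteq> \<Omega>"
      using \<D>(2,3) by blast
    then show "AE z in lebesgue. z \<in> X \<longrightarrow> f z = 0"
      using cbox0 by simp
  qed
  then have "AE z in lebesgue. z \<in> \<Omega> \<longrightarrow> f z = 0"
    by eventually_elim (use \<D>(4) in blast)
  then show ?thesis
    using \<Omega> by (simp add: AE_restrict_space_iff)
qed

subsection \<open>Test functions and weak derivatives\<close>

text \<open>Any compact subset of \<Omega> outside which the function vanishes may stand in for the
  support, so supports of derivatives, differences and products are never computed.\<close>

lemma test_functionsI:
  assumes "\<And>k. Ck k \<phi>" "compact K" "K \<subseteq> \<Omega>" "\<And>z. z \<notin> K \<Longrightarrow> \<phi> z = 0"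
  shows "\<phi> \<in> test_functions \<Omega>"
proof -
  have "closure {z. \<phi> z \<noteq> 0} \<subseteq> K"
    using assms by (intro closure_minimal compact_imp_closed) auto
  moreover from this have "bounded {z. \<phi> z \<noteq> 0}"
    using assms(2) closure_subset bounded_subset compact_imp_bounded by meson
  ultimately show ?thesis
    using assms(1,3) by (auto simp: test_functions_def)
qed

lemma test_functionsE:
  assumes "\<phi> \<in> test_functions \<Omega>"
  obtains K where "compact K" "K \<subseteq> \<Omega>" "\<And>z. z \<notin> K \<Longrightarrow> \<phi> z = 0"
proof
  show "\<phi> z = 0" if "z \<notin> closure {z. \<phi> z \<noteq> 0}" for z
    using that closure_subset[of "{z. \<phi> z \<noteq> 0}"] by blast
qed (use assms in \<open>auto simp: test_functions_def\<close>)

lemma test_functions_Ck: "\<phi> \<in> test_functions \<Omega> \<Longrightarrow> Ck k \<phi>"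
  by (simp add: test_functions_def)

lemma test_functions_continuous: "\<phi> \<in> test_functions \<Omega> \<Longrightarrow> continuous_on UNIV \<phi>"
  using Ck_imp_continuous test_functions_Ck by blast

text \<open>The complement of \<open>K\<close> is open, so near such a point the function is
  constantly 0 along the horizontal line. Differentiation therefore does not enlarge the compact
  set.\<close>

lemma dx_eq_0_outside:
  assumes "closed K" "\<And>z. z \<notin> K \<Longrightarrow> \<phi> z = 0" "z \<notin> K"
  shows "dx \<phi> z = 0"
proof -
  obtain x y where z: "z = (x, y)" by (cases z)
  let ?U = "(\<lambda>s. (s, y)) -` (- K)"
  have "open ?U"
    using assms(1) by (intro open_vimage) (auto intro!: continuous_intros)
  then have "\<forall>\<^sub>F s in nhds x. s \<in> ?U"
    using assms(3) z by (intro eventually_nhds_in_open) auto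
  then have "\<forall>\<^sub>F s in nhds x. \<phi> (s, y) = 0"
    by eventually_elim (use assms(2) in auto)
  then have "((\<lambda>s. \<phi> (s, y)) has_real_derivative 0) (at x)"
    by (subst DERIV_cong_ev[OF refl _ refl, where g = "\<lambda>_. 0"]) auto
  then show ?thesis
    unfolding z by (rule dx_eqI)
qed

lemma dy_eq_0_outside:
  assumes "closed K" "\<And>z. z \<notin> K \<Longrightarrow> \<phi> z = 0" "z \<notin> K"
  shows "dy \<phi> z = 0"
proof -
  obtain x y where z: "z = (x, y)" by (cases z)
  let ?U = "(\<lambda>t. (x, t)) -` (- K)"
  have "open ?U"
    using assms(1) by (intro open_vimage) (auto intro!: continuous_intros)
  then have "\<forall>\<^sub>F t in nhds y. t \<in> ?U"
    using assms(3) z by (intro eventually_nhds_in_open) auto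
  then have "\<forall>\<^sub>F t in nhds y. \<phi> (x, t) = 0"
    by eventually_elim (use assms(2) in auto)
  then have "((\<lambda>t. \<phi> (x, t)) has_real_derivative 0) (at y)"
    by (subst DERIV_cong_ev[OF refl _ refl, where g = "\<lambda>_. 0"]) auto
  then show ?thesis
    unfolding z by (rule dy_eqI)
qed

lemma test_functions_dx:
  assumes "\<phi> \<in> test_functions \<Omega>"
  shows "dx \<phi> \<in> test_functions \<Omega>"
proof -
  obtain K where K: "compact K" "K \<subseteq> \<Omega>" "\<And>z. z \<notin> K \<Longrightarrow> \<phi> z = 0"
    using assms by (rule test_functionsE) blast
  show ?thesis
    by (rule test_functionsI[OF Ck_dx[OF test_functions_Ck[OF assms]] K(1,2)
          dx_eq_0_outside[OF compact_imp_closed[OF K(1)] K(3)]])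
qed

lemma test_functions_dy:
  assumes "\<phi> \<in> test_functions \<Omega>"
  shows "dy \<phi> \<in> test_functions \<Omega>"
proof -
  obtain K where K: "compact K" "K \<subseteq> \<Omega>" "\<And>z. z \<notin> K \<Longrightarrow> \<phi> z = 0"
    using assms by (rule test_functionsE) blast
  show ?thesis
    by (rule test_functionsI[OF Ck_dy[OF test_functions_Ck[OF assms]] K(1,2)
          dy_eq_0_outside[OF compact_imp_closed[OF K(1)] K(3)]])
qed

lemma test_functions_iterated_deriv:
  assumes "\<phi> \<in> test_functions \<Omega>"
  shows "(dx ^^ i) ((dy ^^ j) \<phi>) \<in> test_functions \<Omega>"
proof (induction i)
  case 0
  show ?case
    by (induction j) (simp_all add: assms test_functions_dy)
qed (simp add: test_functions_dx)

lemma test_functions_diff: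
  assumes \<phi>: "\<phi> \<in> test_functions \<Omega>" and \<psi>: "\<psi> \<in> test_functions \<Omega>"
  shows "(\<lambda>z. \<phi> z - \<psi> z) \<in> test_functions \<Omega>"
proof -
  obtain K where K: "compact K" "K \<subseteq> \<Omega>" "\<And>z. z \<notin> K \<Longrightarrow> \<phi> z = 0"
    using \<phi> by (rule test_functionsE) blast
  obtain L where L: "compact L" "L \<subseteq> \<Omega>" "\<And>z. z \<notin> L \<Longrightarrow> \<psi> z = 0"
    using \<psi> by (rule test_functionsE) blast
  show ?thesis
    by (rule test_functionsI[OF Ck_diff[OF test_functions_Ck[OF \<phi>] test_functions_Ck[OF \<psi>]]
          compact_Un[OF K(1) L(1)]]) (use K L in auto)
qed

lemma test_functions_mult:
  assumes \<phi>: "\<phi> \<in> test_functions \<Omega>" and \<psi>: "\<psi> \<in> test_functions \<Omega>"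
  shows "(\<lambda>z. \<phi> z * \<psi> z) \<in> test_functions \<Omega>"
proof -
  obtain K where K: "compact K" "K \<subseteq> \<Omega>" "\<And>z. z \<notin> K \<Longrightarrow> \<phi> z = 0"
    using \<phi> by (rule test_functionsE) blast
  show ?thesis
    by (rule test_functionsI[OF Ck_mult[OF test_functions_Ck[OF \<phi>] test_functions_Ck[OF \<psi>]] K(1,2)])
      (simp add: K(3))
qed

lemma integrable_loc_integrable_test:
  assumes "open \<Omega>" "loc_integrable \<Omega> f" "\<phi> \<in> test_functions \<Omega>"
  shows "integrable (lebesgue_on \<Omega>) (\<lambda>z. f z * \<phi> z)"
proof -
  obtain K where K: "compact K" "K \<subseteq> \<Omega>" "\<And>z. z \<notin> K \<Longrightarrow> \<phi> z = 0"
    using assms(3) by (rule test_functionsE) blast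
  have \<Omega>: "\<Omega> \<in> sets lebesgue"
    using assms(1) by auto
  show ?thesis
    by (rule integrable_loc_integrable_mult[OF assms(2) K(1,2) \<Omega> test_functions_continuous[OF assms(3)] K(3)])
qed

lemma continuous_loc_integrable:
  assumes "open \<Omega>" and f: "continuous_on UNIV f"
  shows "loc_integrable \<Omega> f"
proof -
  have "f \<in> borel_measurable (lebesgue_on \<Omega>)"
    using continuous_on_subset[OF f subset_UNIV] \<open>open \<Omega>\<close>
    by (intro continuous_imp_measurable_on_sets_lebesgue) auto
  moreover have "integrable (lebesgue_on K) f" if "compact K" for K
  proof -
    have "integrable lborel (\<lambda>z. indicator K z *\<^sub>R f z)"
      using that continuous_on_subset[OF f subset_UNIV] by (rule borel_integrable_compact)
    then have "integrable lebesgue (\<lambda>z. indicator K z *\<^sub>R f z)"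
      using integrable_completion[of "\<lambda>z. indicator K z *\<^sub>R f z" lborel] borel_measurable_integrable by blast
    then show ?thesis
      using lmeasurable_compact[OF that] by (simp add: integrable_restrict_space fmeasurableD)
  qed
  ultimately show ?thesis by (simp add: loc_integrable_def)
qed

lemma loc_integrable_diff:
  "loc_integrable \<Omega> f \<Longrightarrow> loc_integrable \<Omega> g \<Longrightarrow> loc_integrable \<Omega> (\<lambda>z. f z - g z)"
  by (simp add: loc_integrable_def borel_measurable_diff)

section \<open>Uniqueness and differences of weak derivatives\<close>

lemma is_weak_derivD:
  "is_weak_deriv \<Omega> i j f g \<Longrightarrow> \<phi> \<in> test_functions \<Omega> \<Longrightarrow>
    (\<integral>z. f z * (dx ^^ i) ((dy ^^ j) \<phi>) z \<partial>lebesgue_on \<Omega>)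
    = (-1) ^ (i + j) * (\<integral>z. g z * \<phi> z \<partial>lebesgue_on \<Omega>)"
  by (simp add: is_weak_deriv_def)

lemma is_weak_deriv_unique:
  assumes "open \<Omega>" and 1: "is_weak_deriv \<Omega> i j f g" and 2: "is_weak_deriv \<Omega> i j f g'"
  shows "AE z in lebesgue_on \<Omega>. g z = g' z"
proof -
  have g: "loc_integrable \<Omega> g" and g': "loc_integrable \<Omega> g'"
    using 1 2 by (auto simp: is_weak_deriv_def)
  have "AE z in lebesgue_on \<Omega>. g z - g' z = 0"
  proof (rule loc_integrable_AE_eq_0[OF \<open>open \<Omega>\<close> loc_integrable_diff[OF g g']])
    fix \<phi> assume \<phi>: "\<phi> \<in> test_functions \<Omega>"
    have "(-1) ^ (i + j) * (\<integral>z. g z * \<phi> z \<partial>lebesgue_on \<Omega>)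
        = (-1) ^ (i + j) * (\<integral>z. g' z * \<phi> z \<partial>lebesgue_on \<Omega>)"
      by (rule trans[OF is_weak_derivD[OF 1 \<phi>, symmetric] is_weak_derivD[OF 2 \<phi>]])
    then have "(\<integral>z. g z * \<phi> z \<partial>lebesgue_on \<Omega>) = (\<integral>z. g' z * \<phi> z \<partial>lebesgue_on \<Omega>)"
      by simp
    then show "(\<integral>z. (g z - g' z) * \<phi> z \<partial>lebesgue_on \<Omega>) = 0"
      using integrable_loc_integrable_test[OF \<open>open \<Omega>\<close> g \<phi>] integrable_loc_integrable_test[OF \<open>open \<Omega>\<close> g' \<phi>]
      by (simp add: left_diff_distrib)
  qed
  then show ?thesis by simp
qed

text \<open>Any witness makes the choice meaningful, though the chosen function need not be that
  witness; the two are compared only almost everywhere.\<close>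

lemma is_weak_deriv_weak_deriv: "is_weak_deriv \<Omega> i j f g \<Longrightarrow> is_weak_deriv \<Omega> i j f (weak_deriv \<Omega> i j f)"
  unfolding weak_deriv_def by (rule someI[where P = "is_weak_deriv \<Omega> i j f"])

lemma weak_deriv_AE_eq:
  "open \<Omega> \<Longrightarrow> is_weak_deriv \<Omega> i j f g \<Longrightarrow> AE z in lebesgue_on \<Omega>. weak_deriv \<Omega> i j f z = g z"
  using is_weak_deriv_unique is_weak_deriv_weak_deriv by blast

lemma is_weak_deriv_diff:
  assumes "open \<Omega>" and 1: "is_weak_deriv \<Omega> i j f f'" and 2: "is_weak_deriv \<Omega> i j g g'"
  shows "is_weak_deriv \<Omega> i j (\<lambda>z. f z - g z) (\<lambda>z. f' z - g' z)"
proof -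
  have loc: "loc_integrable \<Omega> f" "loc_integrable \<Omega> f'" "loc_integrable \<Omega> g" "loc_integrable \<Omega> g'"
    using 1 2 by (auto simp: is_weak_deriv_def)
  note int = integrable_loc_integrable_test[OF \<open>open \<Omega>\<close>]
  have "(\<integral>z. (f z - g z) * (dx ^^ i) ((dy ^^ j) \<phi>) z \<partial>lebesgue_on \<Omega>)
      = (-1) ^ (i + j) * (\<integral>z. (f' z - g' z) * \<phi> z \<partial>lebesgue_on \<Omega>)"
    if \<phi>: "\<phi> \<in> test_functions \<Omega>" for \<phi>
  proof -
    note \<phi>' = test_functions_iterated_deriv[OF \<phi>, of i j]
    have "(\<integral>z. (f z - g z) * (dx ^^ i) ((dy ^^ j) \<phi>) z \<partial>lebesgue_on \<Omega>)
      = (\<integral>z. f z * (dx ^^ i) ((dy ^^ j) \<phi>) z \<partial>lebesgue_on \<Omega>)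
        - (\<integral>z. g z * (dx ^^ i) ((dy ^^ j) \<phi>) z \<partial>lebesgue_on \<Omega>)"
      using int[OF loc(1) \<phi>'] int[OF loc(3) \<phi>'] by (simp add: left_diff_distrib)
    also have "\<dots> = (-1) ^ (i + j) * (\<integral>z. f' z * \<phi> z \<partial>lebesgue_on \<Omega>)
        - (-1) ^ (i + j) * (\<integral>z. g' z * \<phi> z \<partial>lebesgue_on \<Omega>)"
      by (simp only: is_weak_derivD[OF 1 \<phi>] is_weak_derivD[OF 2 \<phi>])
    also have "\<dots> = (-1) ^ (i + j) * (\<integral>z. (f' z - g' z) * \<phi> z \<partial>lebesgue_on \<Omega>)"
      using int[OF loc(2) \<phi>] int[OF loc(4) \<phi>] by (simp add: left_diff_distrib right_diff_distrib)
    finally show ?thesis .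
  qed
  then show ?thesis
    using loc by (simp add: is_weak_deriv_def loc_integrable_diff)
qed

lemma is_weak_deriv_0_0: "loc_integrable \<Omega> f \<Longrightarrow> is_weak_deriv \<Omega> 0 0 f f"
  by (simp add: is_weak_deriv_def)

section \<open>Integration by parts for test functions\<close>

lemma integral_lebesgue_on_eq_lborel:
  assumes "\<Omega> \<in> sets lebesgue" "g \<in> borel_measurable borel" "\<And>z. z \<notin> \<Omega> \<Longrightarrow> g z = (0::real)"
  shows "integral\<^sup>L (lebesgue_on \<Omega>) g = integral\<^sup>L lborel g"
proof -
  have "integral\<^sup>L (lebesgue_on \<Omega>) g = (\<integral>z. indicator \<Omega> z *\<^sub>R g z \<partial>lebesgue)"
    using assms(1) by (simp add: integral_restrict_space)
  also have "(\<lambda>z. indicator \<Omega> z *\<^sub>R g z) = g"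
  proof
    show "indicator \<Omega> z *\<^sub>R g z = g z" for z
      using assms(3)[of z] by (cases "z \<in> \<Omega>") simp_all
  qed
  also have "integral\<^sup>L lebesgue g = integral\<^sup>L lborel g"
    by (rule integral_completion) (simp add: assms(2))
  finally show ?thesis .
qed

lemma integral_deriv_compact_support:
  fixes F f :: "real \<Rightarrow> real"
  assumes "\<And>x. (F has_real_derivative f x) (at x)" "continuous_on UNIV f"
    and "\<And>x. \<bar>x\<bar> > R \<Longrightarrow> F x = 0" "\<And>x. \<bar>x\<bar> > R \<Longrightarrow> f x = 0"
  shows "integral\<^sup>L lborel f = 0"
proof -
  \<comment> \<open>Both endpoints must lie strictly beyond \<open>R\<close>, and nothing is known
    about the sign of \<open>R\<close>.\<close>
  let ?b = "\<bar>R\<bar> + 1"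
  have "(\<integral>x. indicator {- ?b .. ?b} x *\<^sub>R f x \<partial>lborel) = F ?b - F (- ?b)"
  proof (rule integral_FTC_Icc)
    show "(F has_vector_derivative f x) (at x within {- ?b..?b})" for x
      using assms(1)[of x] by (simp add: has_real_derivative_iff_has_vector_derivative has_vector_derivative_at_within)
    show "continuous_on {- ?b..?b} f"
      by (rule continuous_on_subset[OF assms(2) subset_UNIV])
  qed simp
  also have "(\<lambda>x. indicator {- ?b .. ?b} x *\<^sub>R f x) = f"
  proof
    fix x show "indicator {- ?b .. ?b} x *\<^sub>R f x = f x"
    proof (cases "x \<in> {- ?b .. ?b}")
      case False
      then have "x < - ?b \<or> ?b < x"
        unfolding atLeastAtMost_iff by linarith
      then have "\<bar>x\<bar> > R"
        using abs_ge_self[of R] abs_ge_self[of x] abs_ge_minus_self[of x] by linarith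
      then have "f x = 0" by (rule assms(4))
      then show ?thesis by (simp only: scaleR_zero_right)
    qed simp
  qed
  also have "F ?b - F (- ?b) = 0"
  proof -
    have "F ?b = 0" "F (- ?b) = 0"
      by (rule assms(3), linarith)+
    then show ?thesis by (simp only: diff_self)
  qed
  finally show ?thesis .
qed

text \<open>By Fubini the inner integral can be taken in the direction of the derivative, where the
  fundamental theorem of calculus gives 0 on every line. The passage to \<open>lborel\<close> makes
  the product structure of the plane available.\<close>

lemma integral_derivs_test_function:
  assumes "open \<Omega>" and \<phi>: "\<phi> \<in> test_functions \<Omega>"
  shows "(\<integral>z. dx \<phi> z \<partial>lebesgue_on \<Omega>) = 0" "(\<integral>z. dy \<phi> z \<partial>lebesgue_on \<Omega>) = 0"
proof -
  obtain K where K: "compact K" "K \<subseteq> \<Omega>" "\<And>z. z \<notin> K \<Longrightarrow> \<phi> z = 0"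
    using \<phi> by (rule test_functionsE) blast
  have \<Omega>: "\<Omega> \<in> sets lebesgue"
    using assms(1) by auto
  obtain R where R: "\<And>z. z \<in> K \<Longrightarrow> norm z \<le> R"
    using compact_imp_bounded[OF K(1)] unfolding bounded_iff by blast
  have outside: "z \<notin> K" if "\<bar>fst z\<bar> > R \<or> \<bar>snd z\<bar> > R" for z
  proof
    assume "z \<in> K"
    then have "norm (fst z, snd z) \<le> R" using R by simp
    with that norm_fst_le[of "fst z" "snd z"] norm_snd_le[of "snd z" "fst z"] show False
      by (simp only: real_norm_def) linarith
  qed
  have int: "integrable lborel g" if "continuous_on UNIV g" "\<And>z. z \<notin> K \<Longrightarrow> g z = (0::real)" for g
  proof -
    have "integrable lborel (\<lambda>z. indicator K z *\<^sub>R g z)"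
      using K(1) continuous_on_subset[OF that(1) subset_UNIV] by (rule borel_integrable_compact)
    also have "(\<lambda>z. indicator K z *\<^sub>R g z) = g"
    proof
      show "indicator K z *\<^sub>R g z = g z" for z
        using that(2)[of z] by (cases "z \<in> K") simp_all
    qed
    finally show ?thesis .
  qed
  have x0: "dx \<phi> z = 0" if "z \<notin> K" for z
    using compact_imp_closed[OF K(1)] K(3) that by (rule dx_eq_0_outside)
  have y0: "dy \<phi> z = 0" if "z \<notin> K" for z
    using compact_imp_closed[OF K(1)] K(3) that by (rule dy_eq_0_outside)
  note cx = test_functions_continuous[OF test_functions_dx[OF \<phi>]]
  note cy = test_functions_continuous[OF test_functions_dy[OF \<phi>]]
  have "(\<integral>z. dx \<phi> z \<partial>lebesgue_on \<Omega>) = integral\<^sup>L lborel (dx \<phi>)"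
    by (rule integral_lebesgue_on_eq_lborel[OF \<Omega>])
      (rule borel_measurable_continuous_onI[OF cx], rule x0, rule contra_subsetD[OF K(2)], assumption)
  also have "\<dots> = integral\<^sup>L (lborel \<Otimes>\<^sub>M lborel) (case_prod (\<lambda>x y. dx \<phi> (x, y)))"
    by (simp add: lborel_prod)
  also have "\<dots> = (\<integral>y. (\<integral>x. dx \<phi> (x, y) \<partial>lborel) \<partial>lborel)"
    by (rule lborel_pair.integral_snd[symmetric]) (simp add: lborel_prod int[OF cx x0])
  also have "(\<lambda>y. \<integral>x. dx \<phi> (x, y) \<partial>lborel) = (\<lambda>y. 0)"
  proof
    fix y
    show "(\<integral>x. dx \<phi> (x, y) \<partial>lborel) = 0"
    proof (rule integral_deriv_compact_support)
      show "((\<lambda>x. \<phi> (x, y)) has_real_derivative dx \<phi> (x, y)) (at x)" for x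
        by (rule Ck_Suc_dx[OF test_functions_Ck[OF \<phi>, of 1, unfolded One_nat_def]])
      show "continuous_on UNIV (\<lambda>x. dx \<phi> (x, y))"
        by (rule continuous_on_compose2[OF cx]) (auto intro!: continuous_intros)
      have *: "(x, y) \<notin> K" if "\<bar>x\<bar> > R" for x
        using that by (intro outside) simp
      show "\<phi> (x, y) = 0" "dx \<phi> (x, y) = 0" if "\<bar>x\<bar> > R" for x
        using K(3)[OF *[OF that]] x0[OF *[OF that]] by blast+
    qed
  qed
  finally show "(\<integral>z. dx \<phi> z \<partial>lebesgue_on \<Omega>) = 0" by simp
  have "(\<integral>z. dy \<phi> z \<partial>lebesgue_on \<Omega>) = integral\<^sup>L lborel (dy \<phi>)"
    by (rule integral_lebesgue_on_eq_lborel[OF \<Omega>])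
      (rule borel_measurable_continuous_onI[OF cy], rule y0, rule contra_subsetD[OF K(2)], assumption)
  also have "\<dots> = integral\<^sup>L (lborel \<Otimes>\<^sub>M lborel) (case_prod (\<lambda>x y. dy \<phi> (x, y)))"
    by (simp add: lborel_prod)
  also have "\<dots> = (\<integral>x. (\<integral>y. dy \<phi> (x, y) \<partial>lborel) \<partial>lborel)"
    by (rule lborel_pair.integral_fst[symmetric]) (simp add: lborel_prod int[OF cy y0])
  also have "(\<lambda>x. \<integral>y. dy \<phi> (x, y) \<partial>lborel) = (\<lambda>x. 0)"
  proof
    fix x
    show "(\<integral>y. dy \<phi> (x, y) \<partial>lborel) = 0"
    proof (rule integral_deriv_compact_support)
      show "((\<lambda>y. \<phi> (x, y)) has_real_derivative dy \<phi> (x, y)) (at y)" for y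
        by (rule Ck_Suc_dy[OF test_functions_Ck[OF \<phi>, of 1, unfolded One_nat_def]])
      show "continuous_on UNIV (\<lambda>y. dy \<phi> (x, y))"
        by (rule continuous_on_compose2[OF cy]) (auto intro!: continuous_intros)
      have *: "(x, y) \<notin> K" if "\<bar>y\<bar> > R" for y
        using that by (intro outside) simp
      show "\<phi> (x, y) = 0" "dy \<phi> (x, y) = 0" if "\<bar>y\<bar> > R" for y
        using K(3)[OF *[OF that]] y0[OF *[OF that]] by blast+
    qed
  qed
  finally show "(\<integral>z. dy \<phi> z \<partial>lebesgue_on \<Omega>) = 0" by simp
qed

lemma test_functions_loc_integrable:
  "open \<Omega> \<Longrightarrow> \<phi> \<in> test_functions \<Omega> \<Longrightarrow> loc_integrable \<Omega> \<phi>"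
  by (simp add: continuous_loc_integrable test_functions_continuous)

text \<open>For a second test function \<psi> the product \<phi>\<psi> is again a test function; its
  derivative integrates to 0, and the product rule rearranges this into the defining
  identity.\<close>

lemma is_weak_deriv_test_function:
  assumes "open \<Omega>" and \<phi>: "\<phi> \<in> test_functions \<Omega>"
  shows "is_weak_deriv \<Omega> 1 0 \<phi> (dx \<phi>)" "is_weak_deriv \<Omega> 0 1 \<phi> (dy \<phi>)"
proof -
  note loc = test_functions_loc_integrable[OF \<open>open \<Omega>\<close>]
  note int = integrable_loc_integrable_test[OF \<open>open \<Omega>\<close>]
  note C1 = test_functions_Ck[of _ _ "Suc 0"]
  have "(\<integral>z. \<phi> z * dx \<psi> z \<partial>lebesgue_on \<Omega>) = - (\<integral>z. dx \<phi> z * \<psi> z \<partial>lebesgue_on \<Omega>)"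
    if \<psi>: "\<psi> \<in> test_functions \<Omega>" for \<psi>
    using integral_derivs_test_function(1)[OF \<open>open \<Omega>\<close> test_functions_mult[OF \<phi> \<psi>]]
      int[OF loc[OF \<phi>] test_functions_dx[OF \<psi>]] int[OF loc[OF test_functions_dx[OF \<phi>]] \<psi>]
    by (simp add: dx_mult[OF C1[OF \<phi>] C1[OF \<psi>]])
  then show "is_weak_deriv \<Omega> 1 0 \<phi> (dx \<phi>)"
    using loc[OF \<phi>] loc[OF test_functions_dx[OF \<phi>]] by (simp add: is_weak_deriv_def)
  have "(\<integral>z. \<phi> z * dy \<psi> z \<partial>lebesgue_on \<Omega>) = - (\<integral>z. dy \<phi> z * \<psi> z \<partial>lebesgue_on \<Omega>)"
    if \<psi>: "\<psi> \<in> test_functions \<Omega>" for \<psi>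
    using integral_derivs_test_function(2)[OF \<open>open \<Omega>\<close> test_functions_mult[OF \<phi> \<psi>]]
      int[OF loc[OF \<phi>] test_functions_dy[OF \<psi>]] int[OF loc[OF test_functions_dy[OF \<phi>]] \<psi>]
    by (simp add: dy_mult[OF C1[OF \<phi>] C1[OF \<psi>]])
  then show "is_weak_deriv \<Omega> 0 1 \<phi> (dy \<phi>)"
    using loc[OF \<phi>] loc[OF test_functions_dy[OF \<phi>]] by (simp add: is_weak_deriv_def)
qed

subsection \<open>Sobolev spaces\<close>

lemma L2_D: "f \<in> L2 \<Omega> \<Longrightarrow> f \<in> borel_measurable (lebesgue_on \<Omega>)"
  "f \<in> L2 \<Omega> \<Longrightarrow> integrable (lebesgue_on \<Omega>) (\<lambda>z. (f z)\<^sup>2)"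
  by (simp_all add: L2_def)

lemma L2_integrable_mult:
  assumes f: "f \<in> L2 \<Omega>" and g: "g \<in> L2 \<Omega>"
  shows "integrable (lebesgue_on \<Omega>) (\<lambda>z. f z * g z)"
proof (rule Bochner_Integration.integrable_bound)
  show "integrable (lebesgue_on \<Omega>) (\<lambda>z. (f z)\<^sup>2 + (g z)\<^sup>2)"
    using L2_D(2)[OF f] L2_D(2)[OF g] by (rule Bochner_Integration.integrable_add)
  show "(\<lambda>z. f z * g z) \<in> borel_measurable (lebesgue_on \<Omega>)"
    using L2_D(1)[OF f] L2_D(1)[OF g] by (rule borel_measurable_times)
  show "AE z in lebesgue_on \<Omega>. norm (f z * g z) \<le> norm ((f z)\<^sup>2 + (g z)\<^sup>2)"
  proof (intro AE_I2)
    fix z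
    have "2 * (\<bar>f z\<bar> * \<bar>g z\<bar>) \<le> (f z)\<^sup>2 + (g z)\<^sup>2"
      using zero_le_power2[of "\<bar>f z\<bar> - \<bar>g z\<bar>"] by (simp add: power2_diff)
    moreover have "0 \<le> \<bar>f z\<bar> * \<bar>g z\<bar>"
      by simp
    ultimately show "norm (f z * g z) \<le> norm ((f z)\<^sup>2 + (g z)\<^sup>2)"
      unfolding real_norm_def abs_mult by linarith
  qed
qed

lemma L2_diff:
  assumes f: "f \<in> L2 \<Omega>" and g: "g \<in> L2 \<Omega>"
  shows "(\<lambda>z. f z - g z) \<in> L2 \<Omega>"
proof -
  have "integrable (lebesgue_on \<Omega>) (\<lambda>z. (f z)\<^sup>2 + (g z)\<^sup>2 - 2 * (f z * g z))"
    by (intro Bochner_Integration.integrable_diff Bochner_Integration.integrable_add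
        integrable_mult_right L2_D(2) L2_integrable_mult f g)
  then show ?thesis
    using L2_D(1)[OF f] L2_D(1)[OF g] by (simp add: L2_def power2_diff borel_measurable_diff mult.assoc)
qed

lemma L2_AE_cong:
  assumes f: "f \<in> L2 \<Omega>" and g: "g \<in> borel_measurable (lebesgue_on \<Omega>)"
    and eq: "AE z in lebesgue_on \<Omega>. g z = f z"
  shows "g \<in> L2 \<Omega>"
proof -
  have "integrable (lebesgue_on \<Omega>) (\<lambda>z. (g z)\<^sup>2)"
    using L2_D(2)[OF f]
  proof (rule integrable_cong_AE_imp)
    show "(\<lambda>z. (g z)\<^sup>2) \<in> borel_measurable (lebesgue_on \<Omega>)"
      using g by (rule borel_measurable_power)
    show "AE z in lebesgue_on \<Omega>. (f z)\<^sup>2 = (g z)\<^sup>2"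
      using eq by eventually_elim simp
  qed
  then show ?thesis using g by (simp add: L2_def)
qed

lemma bounded_coeffE:
  assumes "bounded_coeff \<Omega> a"
  obtains C where "\<And>z. z \<in> \<Omega> \<Longrightarrow> \<bar>a z\<bar> \<le> C"
proof -
  obtain C where "\<forall>x\<in>a ` \<Omega>. norm x \<le> C"
    using assms unfolding bounded_coeff_def bounded_iff by blast
  then show ?thesis
    by (intro that[of C]) simp
qed

lemma L2_bounded_mult:
  assumes \<Omega>: "\<Omega> \<in> sets lebesgue" and a: "bounded_coeff \<Omega> a" and f: "f \<in> L2 \<Omega>"
  shows "(\<lambda>z. a z * f z) \<in> L2 \<Omega>"
proof -
  obtain C where C: "\<And>z. z \<in> \<Omega> \<Longrightarrow> \<bar>a z\<bar> \<le> C"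
    using a by (rule bounded_coeffE) (rule that)
  have m: "(\<lambda>z. a z * f z) \<in> borel_measurable (lebesgue_on \<Omega>)"
    using a L2_D(1)[OF f] by (intro borel_measurable_times) (simp_all add: bounded_coeff_def)
  have "integrable (lebesgue_on \<Omega>) (\<lambda>z. C\<^sup>2 * (f z)\<^sup>2)"
    by (intro integrable_mult_right L2_D(2)[OF f])
  then have "integrable (lebesgue_on \<Omega>) (\<lambda>z. (a z * f z)\<^sup>2)"
  proof (rule Bochner_Integration.integrable_bound)
    show "(\<lambda>z. (a z * f z)\<^sup>2) \<in> borel_measurable (lebesgue_on \<Omega>)"
      using m by (rule borel_measurable_power)
    show "AE z in lebesgue_on \<Omega>. norm ((a z * f z)\<^sup>2) \<le> norm (C\<^sup>2 * (f z)\<^sup>2)"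
    proof (intro AE_I2)
      fix z assume "z \<in> space (lebesgue_on \<Omega>)"
      then have "z \<in> \<Omega>" by (simp add: space_restrict_space)
      then have "(a z)\<^sup>2 \<le> C\<^sup>2"
        using C[of z] by (intro power2_le_iff_abs_le[THEN iffD2]) auto
      then show "norm ((a z * f z)\<^sup>2) \<le> norm (C\<^sup>2 * (f z)\<^sup>2)"
        by (simp add: power_mult_distrib mult_right_mono)
    qed
  qed
  with m show ?thesis by (simp add: L2_def)
qed

text \<open>Membership in \<open>sobolev\<close> provides some square integrable derivative, which
  need not be the chosen one; almost-everywhere uniqueness transfers square integrability.\<close>

lemma sobolev_weak_deriv:
  assumes "open \<Omega>" "f \<in> sobolev \<Omega> m" "i + j \<le> m"
  shows "is_weak_deriv \<Omega> i j f (weak_deriv \<Omega> i j f)" "weak_deriv \<Omega> i j f \<in> L2 \<Omega>"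
proof -
  obtain g where g: "g \<in> L2 \<Omega>" "is_weak_deriv \<Omega> i j f g"
    using assms(2,3) unfolding sobolev_def by blast
  show wd: "is_weak_deriv \<Omega> i j f (weak_deriv \<Omega> i j f)"
    using g(2) by (rule is_weak_deriv_weak_deriv)
  show "weak_deriv \<Omega> i j f \<in> L2 \<Omega>"
    using g(1) _ weak_deriv_AE_eq[OF assms(1) g(2)]
    by (rule L2_AE_cong) (use wd in \<open>simp add: is_weak_deriv_def loc_integrable_def\<close>)
qed

lemma sobolev_imp_L2: "f \<in> sobolev \<Omega> m \<Longrightarrow> f \<in> L2 \<Omega>"
  by (simp add: sobolev_def)

lemma sobolev_antimono: "m \<le> n \<Longrightarrow> sobolev \<Omega> n \<subseteq> sobolev \<Omega> m"
  by (auto simp: sobolev_def)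

lemma sobolev_diff:
  assumes "open \<Omega>" and f: "f \<in> sobolev \<Omega> m" and g: "g \<in> sobolev \<Omega> m"
  shows "(\<lambda>z. f z - g z) \<in> sobolev \<Omega> m"
  unfolding sobolev_def mem_Collect_eq
proof (intro conjI allI impI)
  show "(\<lambda>z. f z - g z) \<in> L2 \<Omega>"
    by (rule L2_diff[OF sobolev_imp_L2[OF f] sobolev_imp_L2[OF g]])
  fix i j assume ij: "i + j \<le> m"
  show "\<exists>h\<in>L2 \<Omega>. is_weak_deriv \<Omega> i j (\<lambda>z. f z - g z) h"
    using is_weak_deriv_diff[OF assms(1) sobolev_weak_deriv(1)[OF assms(1) f ij]
        sobolev_weak_deriv(1)[OF assms(1) g ij]]
      L2_diff[OF sobolev_weak_deriv(2)[OF assms(1) f ij] sobolev_weak_deriv(2)[OF assms(1) g ij]]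
    by (rule bexI)
qed

lemma weak_deriv_diff_AE:
  assumes "open \<Omega>" "f \<in> sobolev \<Omega> m" "g \<in> sobolev \<Omega> m" "i + j \<le> m"
  shows "AE z in lebesgue_on \<Omega>. weak_deriv \<Omega> i j (\<lambda>z. f z - g z) z
    = weak_deriv \<Omega> i j f z - weak_deriv \<Omega> i j g z"
  by (rule weak_deriv_AE_eq[OF assms(1) is_weak_deriv_diff[OF assms(1)
        sobolev_weak_deriv(1)[OF assms(1,2,4)] sobolev_weak_deriv(1)[OF assms(1,3,4)]]])

text \<open>\<open>sobolev_norm\<close> uses a chosen representative even for order zero, which this
  replaces by the function itself.\<close>

lemma weak_deriv_0_0_AE:
  assumes "open \<Omega>" "f \<in> sobolev \<Omega> m"
  shows "AE z in lebesgue_on \<Omega>. weak_deriv \<Omega> 0 0 f z = f z"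
proof -
  have "loc_integrable \<Omega> f"
    using sobolev_weak_deriv(1)[OF assms, of 0 0] by (simp add: is_weak_deriv_def)
  then show ?thesis
    by (intro weak_deriv_AE_eq[OF assms(1)] is_weak_deriv_0_0)
qed

text \<open>This is the integrand of the squared H1 norm, with \<open>f\<close> itself in place of
  its weak derivative of order zero, so that norm estimates become pointwise inequalities.\<close>

definition h1_density :: "(real \<times> real) set \<Rightarrow> (real \<times> real \<Rightarrow> real) \<Rightarrow> real \<times> real \<Rightarrow> real" where
  "h1_density \<Omega> f z = (f z)\<^sup>2 + (wdx \<Omega> f z)\<^sup>2 + (wdy \<Omega> f z)\<^sup>2"

lemma sobolev_1_wdx_wdy:
  assumes "open \<Omega>" "f \<in> sobolev \<Omega> 1"
  shows "wdx \<Omega> f \<in> L2 \<Omega>" "wdy \<Omega> f \<in> L2 \<Omega>"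
  by (rule sobolev_weak_deriv(2)[OF assms]; simp)+

lemma integrable_h1_density:
  assumes "open \<Omega>" "f \<in> sobolev \<Omega> 1"
  shows "integrable (lebesgue_on \<Omega>) (h1_density \<Omega> f)"
  unfolding h1_density_def
  by (intro Bochner_Integration.integrable_add L2_D(2) sobolev_1_wdx_wdy assms
      sobolev_imp_L2[OF assms(2)])

lemma sobolev_norm_nonneg: "0 \<le> sobolev_norm \<Omega> m f"
  unfolding sobolev_norm_def by (intro real_sqrt_ge_zero sum_nonneg) auto

lemma sobolev_norm_1_power2:
  assumes "open \<Omega>" "f \<in> sobolev \<Omega> 1"
  shows "(sobolev_norm \<Omega> 1 f)\<^sup>2 = integral\<^sup>L (lebesgue_on \<Omega>) (h1_density \<Omega> f)"
proof -
  let ?I = "\<lambda>(i, j). \<integral>z. (weak_deriv \<Omega> i j f z)\<^sup>2 \<partial>lebesgue_on \<Omega>"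
  have ix: "{(i, j). i + j \<le> (1::nat)} = {(0, 0), (1, 0), (0, 1)}"
    by auto
  have "(sobolev_norm \<Omega> 1 f)\<^sup>2 = sum ?I {(i, j). i + j \<le> 1}"
    unfolding sobolev_norm_def by (intro real_sqrt_pow2 sum_nonneg) auto
  also have "\<dots> = ?I (0, 0) + ?I (1, 0) + ?I (0, 1)"
    unfolding ix by simp
  also have "?I (0, 0) = (\<integral>z. (f z)\<^sup>2 \<partial>lebesgue_on \<Omega>)"
    unfolding prod.case
  proof (rule integral_cong_AE)
    show "AE z in lebesgue_on \<Omega>. (weak_deriv \<Omega> 0 0 f z)\<^sup>2 = (f z)\<^sup>2"
      using weak_deriv_0_0_AE[OF assms] by eventually_elim simp
  qed (rule borel_measurable_power L2_D(1) sobolev_weak_deriv(2)[OF assms] sobolev_imp_L2[OF assms(2)] | simp)+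
  finally show ?thesis
    unfolding h1_density_def prod.case
    using L2_D(2)[OF sobolev_imp_L2[OF assms(2)]] L2_D(2)[OF sobolev_1_wdx_wdy(1)[OF assms]]
      L2_D(2)[OF sobolev_1_wdx_wdy(2)[OF assms]]
    by (simp del: One_nat_def)
qed

lemma wdx_wdy_diff_AE:
  assumes "open \<Omega>" "f \<in> sobolev \<Omega> 1" "g \<in> sobolev \<Omega> 1"
  shows "AE z in lebesgue_on \<Omega>. wdx \<Omega> (\<lambda>z. f z - g z) z = wdx \<Omega> f z - wdx \<Omega> g z
    \<and> wdy \<Omega> (\<lambda>z. f z - g z) z = wdy \<Omega> f z - wdy \<Omega> g z"
  by (rule AE_conjI; rule weak_deriv_diff_AE[OF assms]; simp)

section \<open>Test functions in H1, and their closure \<open>sobolev0\<close>\<close>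

lemma test_functions_L2:
  assumes "open \<Omega>" "\<phi> \<in> test_functions \<Omega>"
  shows "\<phi> \<in> L2 \<Omega>"
proof -
  have loc: "loc_integrable \<Omega> \<phi>"
    using assms by (rule test_functions_loc_integrable)
  then show ?thesis
    using integrable_loc_integrable_test[OF assms(1) loc assms(2)]
    by (simp add: L2_def power2_eq_square loc_integrable_def)
qed

lemma test_functions_sobolev:
  assumes "open \<Omega>" and \<phi>: "\<phi> \<in> test_functions \<Omega>"
  shows "\<phi> \<in> sobolev \<Omega> 1"
  unfolding sobolev_def mem_Collect_eq
proof (intro conjI allI impI)
  show "\<phi> \<in> L2 \<Omega>"
    using assms by (rule test_functions_L2)
  fix i j :: nat assume "i + j \<le> 1"
  then consider "i = 0" "j = 0" | "i = 1" "j = 0" | "i = 0" "j = 1" by linarith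
  then show "\<exists>g\<in>L2 \<Omega>. is_weak_deriv \<Omega> i j \<phi> g"
  proof cases
    case 1
    show ?thesis
      unfolding 1
      using is_weak_deriv_0_0[OF test_functions_loc_integrable[OF assms]] test_functions_L2[OF assms]
      by (rule bexI)
  next
    case 2
    show ?thesis
      unfolding 2
      using is_weak_deriv_test_function(1)[OF assms]
        test_functions_L2[OF assms(1) test_functions_dx[OF \<phi>]]
      by (rule bexI)
  next
    case 3
    show ?thesis
      unfolding 3
      using is_weak_deriv_test_function(2)[OF assms]
        test_functions_L2[OF assms(1) test_functions_dy[OF \<phi>]]
      by (rule bexI)
  qed
qed

lemma wdx_wdy_test_function_AE:
  assumes "open \<Omega>" and \<phi>: "\<phi> \<in> test_functions \<Omega>"
  shows "AE z in lebesgue_on \<Omega>. wdx \<Omega> \<phi> z = dx \<phi> z \<and> wdy \<Omega> \<phi> z = dy \<phi> z"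
  by (rule AE_conjI; rule weak_deriv_AE_eq[OF assms(1)], rule is_weak_deriv_test_function[OF assms])

lemma sobolev0_imp_sobolev: "f \<in> sobolev0 \<Omega> \<Longrightarrow> f \<in> sobolev \<Omega> 1"
  by (simp add: sobolev0_def)

lemma sobolev0_approx:
  assumes "f \<in> sobolev0 \<Omega>" "\<epsilon> > 0"
  obtains \<phi> where "\<phi> \<in> test_functions \<Omega>" "sobolev_norm \<Omega> 1 (\<lambda>z. \<phi> z - f z) < \<epsilon>"
  using assms unfolding sobolev0_def by auto

text \<open>Integrating (a - b)^2 <= 2 a^2 + 2 b^2 gives a squared form of the triangle inequality,
  sharp enough to close \<open>sobolev0\<close> under differences.\<close>

lemma sobolev_norm_1_diff_power2_le:
  assumes "open \<Omega>" and f: "f \<in> sobolev \<Omega> 1" and g: "g \<in> sobolev \<Omega> 1"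
  shows "(sobolev_norm \<Omega> 1 (\<lambda>z. f z - g z))\<^sup>2
    \<le> 2 * (sobolev_norm \<Omega> 1 f)\<^sup>2 + 2 * (sobolev_norm \<Omega> 1 g)\<^sup>2"
proof -
  have sq: "(a - b)\<^sup>2 \<le> 2 * a\<^sup>2 + 2 * b\<^sup>2" for a b :: real
    using zero_le_power2[of "a + b"] by (simp add: power2_diff power2_sum)
  note d = sobolev_diff[OF assms]
  note int = integrable_h1_density[OF assms(1)]
  have "integral\<^sup>L (lebesgue_on \<Omega>) (h1_density \<Omega> (\<lambda>z. f z - g z))
      \<le> (\<integral>z. 2 * h1_density \<Omega> f z + 2 * h1_density \<Omega> g z \<partial>lebesgue_on \<Omega>)"
  proof (rule integral_mono_AE)
    show "AE z in lebesgue_on \<Omega>. h1_density \<Omega> (\<lambda>z. f z - g z) z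
        \<le> 2 * h1_density \<Omega> f z + 2 * h1_density \<Omega> g z"
      using wdx_wdy_diff_AE[OF assms]
    proof eventually_elim
      case (elim z)
      show ?case
        using add_mono[OF add_mono[OF sq[of "f z" "g z"] sq[of "wdx \<Omega> f z" "wdx \<Omega> g z"]]
            sq[of "wdy \<Omega> f z" "wdy \<Omega> g z"]]
        unfolding h1_density_def conjunct1[OF elim] conjunct2[OF elim] by (simp only: distrib_left ac_simps)
    qed
  qed (intro int d Bochner_Integration.integrable_add integrable_mult_right f g)+
  also have "\<dots> = 2 * integral\<^sup>L (lebesgue_on \<Omega>) (h1_density \<Omega> f)
      + 2 * integral\<^sup>L (lebesgue_on \<Omega>) (h1_density \<Omega> g)"
    using int[OF f] int[OF g] by simp
  finally show ?thesis
    by (simp only: sobolev_norm_1_power2[OF assms(1)] f g d)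
qed

lemma sobolev0_diff:
  assumes "open \<Omega>" and f: "f \<in> sobolev0 \<Omega>" and g: "g \<in> sobolev0 \<Omega>"
  shows "(\<lambda>z. f z - g z) \<in> sobolev0 \<Omega>"
  unfolding sobolev0_def mem_Collect_eq
proof (intro conjI allI impI)
  note f1 = sobolev0_imp_sobolev[OF f] and g1 = sobolev0_imp_sobolev[OF g]
  show "(\<lambda>z. f z - g z) \<in> sobolev \<Omega> 1"
    by (rule sobolev_diff[OF assms(1) f1 g1])
  fix \<epsilon> :: real assume "\<epsilon> > 0"
  then have "\<epsilon> / 2 > 0" by simp
  obtain \<phi> where \<phi>: "\<phi> \<in> test_functions \<Omega>" "sobolev_norm \<Omega> 1 (\<lambda>z. \<phi> z - f z) < \<epsilon> / 2"
    using f \<open>\<epsilon> / 2 > 0\<close> by (rule sobolev0_approx)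
  obtain \<psi> where \<psi>: "\<psi> \<in> test_functions \<Omega>" "sobolev_norm \<Omega> 1 (\<lambda>z. \<psi> z - g z) < \<epsilon> / 2"
    using g \<open>\<epsilon> / 2 > 0\<close> by (rule sobolev0_approx)
  have "(sobolev_norm \<Omega> 1 (\<lambda>z. (\<phi> z - f z) - (\<psi> z - g z)))\<^sup>2
      \<le> 2 * (sobolev_norm \<Omega> 1 (\<lambda>z. \<phi> z - f z))\<^sup>2 + 2 * (sobolev_norm \<Omega> 1 (\<lambda>z. \<psi> z - g z))\<^sup>2"
    by (intro sobolev_norm_1_diff_power2_le sobolev_diff assms(1) test_functions_sobolev \<phi>(1) \<psi>(1) f1 g1)
  \<comment> \<open>Accuracy \<epsilon>/2 for each approximation is exactly what the factors 2
    require: the sum is \<epsilon> squared.\<close>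
  also have "\<dots> < 2 * (\<epsilon> / 2)\<^sup>2 + 2 * (\<epsilon> / 2)\<^sup>2"
    by (intro add_strict_mono mult_strict_left_mono power_strict_mono \<phi>(2) \<psi>(2) sobolev_norm_nonneg) simp_all
  also have "\<dots> = \<epsilon>\<^sup>2"
    by (simp add: power_divide)
  finally have "sobolev_norm \<Omega> 1 (\<lambda>z. (\<phi> z - f z) - (\<psi> z - g z)) < \<epsilon>"
    using less_imp_le[OF \<open>\<epsilon> > 0\<close>] by (rule power2_less_imp_less)
  moreover have "(\<lambda>z. (\<phi> z - f z) - (\<psi> z - g z)) = (\<lambda>z. (\<phi> z - \<psi> z) - (f z - g z))"
    by (rule ext) simp
  ultimately show "\<exists>\<eta>\<in>test_functions \<Omega>. sobolev_norm \<Omega> 1 (\<lambda>z. \<eta> z - (f z - g z)) < \<epsilon>"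
    by (intro bexI[OF _ test_functions_diff[OF \<phi>(1) \<psi>(1)]]) (simp only:)
qed

subsection \<open>The bilinear form\<close>

text \<open>Young's inequality with a free weight, obtained by expanding the square of
  \<open>2 * t * \<bar>a\<bar> - \<bar>b\<bar>\<close>.\<close>

lemma abs_mult_le_weighted_squares:
  fixes a b t :: real
  assumes "t > 0"
  shows "\<bar>a\<bar> * \<bar>b\<bar> \<le> t * a\<^sup>2 + b\<^sup>2 / (4 * t)"
proof -
  have "0 \<le> (2 * t * \<bar>a\<bar> - \<bar>b\<bar>)\<^sup>2 / (4 * t)"
    using assms by (intro divide_nonneg_pos zero_le_power2) simp
  also have "\<dots> = t * a\<^sup>2 + b\<^sup>2 / (4 * t) - \<bar>a\<bar> * \<bar>b\<bar>"
    using assms by (simp add: power2_diff power_mult_distrib field_simps power2_eq_square)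
  finally show ?thesis by simp
qed

text \<open>The restriction to \<epsilon> <= 1 lets higher powers of \<epsilon> be absorbed into
  \<open>C\<close> by the user of this criterion.\<close>

lemma real_le_0_if_le_small_multiples:
  fixes x C :: real
  assumes "\<And>\<epsilon>. 0 < \<epsilon> \<Longrightarrow> \<epsilon> \<le> 1 \<Longrightarrow> x \<le> \<epsilon> * C"
  shows "x \<le> 0"
proof (rule tendsto_lowerbound)
  show "((\<lambda>\<epsilon>. \<epsilon> * C) \<longlongrightarrow> 0) (at_right 0)"
    by (rule tendsto_eq_intros | simp)+
  show "\<forall>\<^sub>F \<epsilon> in at_right 0. x \<le> \<epsilon> * C"
    using eventually_at_right_real[OF zero_less_one] by eventually_elim (use assms in simp)
qed simp

text \<open>Only the domain and the coefficients are fixed here, so a constant obtained inside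
  cannot depend on the mesh, the discrete space, the source or the solution.\<close>

locale adr_problem =
  fixes \<Omega> :: "(real \<times> real) set" and Dx Dy u v :: "real \<times> real \<Rightarrow> real" and \<mu> :: real
  assumes open_domain: "open \<Omega>"
    and Dx: "bounded_coeff \<Omega> Dx" and Dy: "bounded_coeff \<Omega> Dy"
    and u: "bounded_coeff \<Omega> u" and v: "bounded_coeff \<Omega> v"
    and Dx_pos: "bounded_below \<Omega> Dx" and Dy_pos: "bounded_below \<Omega> Dy"
    and div_free: "divergence_free \<Omega> u v"
    and mu_pos: "\<mu> > 0"
begin

abbreviation "form \<equiv> adr_form \<Omega> Dx Dy u v \<mu>"

definition convection :: "(real \<times> real \<Rightarrow> real) \<Rightarrow> real \<times> real \<Rightarrow> real" where
  "convection f z = f z * (u z * wdx \<Omega> f z + v z * wdy \<Omega> f z)"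

text \<open>A single integrand for the four integrals of \<open>adr_form\<close>; linearity,
  coercivity and the upper bound are all checked on it pointwise.\<close>

definition form_density ::
  "(real \<times> real \<Rightarrow> real) \<Rightarrow> (real \<times> real \<Rightarrow> real) \<Rightarrow> real \<times> real \<Rightarrow> real" where
  "form_density c d z = Dx z * wdx \<Omega> c z * wdx \<Omega> d z + Dy z * wdy \<Omega> c z * wdy \<Omega> d z
     + d z * (u z * wdx \<Omega> c z + v z * wdy \<Omega> c z) + \<mu> * c z * d z"

section \<open>Integrability and bilinearity of the form\<close>

lemma domain_sets: "\<Omega> \<in> sets lebesgue"
  using open_domain by auto

lemma integrable_terms:
  assumes c: "c \<in> sobolev \<Omega> 1" and d: "d \<in> sobolev \<Omega> 1"
  shows "integrable (lebesgue_on \<Omega>) (\<lambda>z. Dx z * wdx \<Omega> c z * wdx \<Omega> d z)"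
    and "integrable (lebesgue_on \<Omega>) (\<lambda>z. Dy z * wdy \<Omega> c z * wdy \<Omega> d z)"
    and "integrable (lebesgue_on \<Omega>) (\<lambda>z. d z * (u z * wdx \<Omega> c z + v z * wdy \<Omega> c z))"
    and "integrable (lebesgue_on \<Omega>) (\<lambda>z. \<mu> * c z * d z)"
proof -
  note L2s = sobolev_1_wdx_wdy[OF open_domain] sobolev_imp_L2
  note bm = L2_bounded_mult[OF domain_sets]
  show "integrable (lebesgue_on \<Omega>) (\<lambda>z. Dx z * wdx \<Omega> c z * wdx \<Omega> d z)"
    "integrable (lebesgue_on \<Omega>) (\<lambda>z. Dy z * wdy \<Omega> c z * wdy \<Omega> d z)"
    by (intro L2_integrable_mult bm Dx Dy L2s c d)+
  show "integrable (lebesgue_on \<Omega>) (\<lambda>z. d z * (u z * wdx \<Omega> c z + v z * wdy \<Omega> c z))"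
    unfolding distrib_left
    by (intro Bochner_Integration.integrable_add L2_integrable_mult bm u v L2s(1,2) c
        sobolev_imp_L2[OF d])
  show "integrable (lebesgue_on \<Omega>) (\<lambda>z. \<mu> * c z * d z)"
    unfolding mult.assoc
    by (intro integrable_mult_right L2_integrable_mult sobolev_imp_L2[OF c] sobolev_imp_L2[OF d])
qed

lemma integrable_form_density:
  "c \<in> sobolev \<Omega> 1 \<Longrightarrow> d \<in> sobolev \<Omega> 1 \<Longrightarrow> integrable (lebesgue_on \<Omega>) (form_density c d)"
  unfolding form_density_def by (intro Bochner_Integration.integrable_add integrable_terms)

lemma form_eq_integral:
  assumes "c \<in> sobolev \<Omega> 1" "d \<in> sobolev \<Omega> 1"
  shows "form c d = integral\<^sup>L (lebesgue_on \<Omega>) (form_density c d)"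
proof -
  note int = integrable_terms[OF assms]
  show ?thesis
    unfolding adr_form_def form_density_def
    by (simp only: int Bochner_Integration.integral_add Bochner_Integration.integrable_add)
qed

lemma form_diff_left:
  assumes f: "f \<in> sobolev \<Omega> 1" and g: "g \<in> sobolev \<Omega> 1" and d: "d \<in> sobolev \<Omega> 1"
  shows "form (\<lambda>z. f z - g z) d = form f d - form g d"
proof -
  note fg = sobolev_diff[OF open_domain f g]
  have "integral\<^sup>L (lebesgue_on \<Omega>) (form_density (\<lambda>z. f z - g z) d)
      = (\<integral>z. form_density f d z - form_density g d z \<partial>lebesgue_on \<Omega>)"
  proof (rule integral_cong_AE)
    show "AE z in lebesgue_on \<Omega>. form_density (\<lambda>z. f z - g z) d z = form_density f d z - form_density g d z"
      using wdx_wdy_diff_AE[OF open_domain f g]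
    proof eventually_elim
      case (elim z)
      show ?case
        unfolding form_density_def conjunct1[OF elim] conjunct2[OF elim] by (simp only: algebra_simps)
    qed
  qed (intro borel_measurable_integrable Bochner_Integration.integrable_diff integrable_form_density
      f g d fg)+
  then show ?thesis
    using integrable_form_density[OF f d] integrable_form_density[OF g d]
    by (simp add: form_eq_integral f g d fg del: One_nat_def)
qed

lemma form_diff_right:
  assumes f: "f \<in> sobolev \<Omega> 1" and g: "g \<in> sobolev \<Omega> 1" and c: "c \<in> sobolev \<Omega> 1"
  shows "form c (\<lambda>z. f z - g z) = form c f - form c g"
proof -
  note fg = sobolev_diff[OF open_domain f g]
  have "integral\<^sup>L (lebesgue_on \<Omega>) (form_density c (\<lambda>z. f z - g z))
      = (\<integral>z. form_density c f z - form_density c g z \<partial>lebesgue_on \<Omega>)"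
  proof (rule integral_cong_AE)
    show "AE z in lebesgue_on \<Omega>. form_density c (\<lambda>z. f z - g z) z = form_density c f z - form_density c g z"
      using wdx_wdy_diff_AE[OF open_domain f g]
    proof eventually_elim
      case (elim z)
      show ?case
        unfolding form_density_def conjunct1[OF elim] conjunct2[OF elim] by (simp only: algebra_simps)
    qed
  qed (intro borel_measurable_integrable Bochner_Integration.integrable_diff integrable_form_density
      f g c fg)+
  then show ?thesis
    using integrable_form_density[OF c f] integrable_form_density[OF c g]
    by (simp add: form_eq_integral f g c fg del: One_nat_def)
qed

section \<open>Uniform bounds on the coefficients\<close>

lemma coefficient_bound:
  obtains B where "B > 0" "\<mu> \<le> B" "\<And>z. z \<in> \<Omega> \<Longrightarrow> \<bar>Dx z\<bar> \<le> B" "\<And>z. z \<in> \<Omega> \<Longrightarrow> \<bar>Dy z\<bar> \<le> B"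
    "\<And>z. z \<in> \<Omega> \<Longrightarrow> \<bar>u z\<bar> \<le> B" "\<And>z. z \<in> \<Omega> \<Longrightarrow> \<bar>v z\<bar> \<le> B"
proof -
  obtain C1 where C1: "\<And>z. z \<in> \<Omega> \<Longrightarrow> \<bar>Dx z\<bar> \<le> C1" using Dx by (rule bounded_coeffE) (rule that)
  obtain C2 where C2: "\<And>z. z \<in> \<Omega> \<Longrightarrow> \<bar>Dy z\<bar> \<le> C2" using Dy by (rule bounded_coeffE) (rule that)
  obtain C3 where C3: "\<And>z. z \<in> \<Omega> \<Longrightarrow> \<bar>u z\<bar> \<le> C3" using u by (rule bounded_coeffE) (rule that)
  obtain C4 where C4: "\<And>z. z \<in> \<Omega> \<Longrightarrow> \<bar>v z\<bar> \<le> C4" using v by (rule bounded_coeffE) (rule that)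
  \<comment> \<open>The absolute values keep the sum positive and above each bound, whatever the
    signs of the bounds.\<close>
  let ?B = "\<mu> + \<bar>C1\<bar> + \<bar>C2\<bar> + \<bar>C3\<bar> + \<bar>C4\<bar>"
  show ?thesis
  proof (rule that[of ?B])
    show "?B > 0" "\<mu> \<le> ?B" using mu_pos by linarith+
    fix z assume z: "z \<in> \<Omega>"
    show "\<bar>Dx z\<bar> \<le> ?B" "\<bar>Dy z\<bar> \<le> ?B" "\<bar>u z\<bar> \<le> ?B" "\<bar>v z\<bar> \<le> ?B"
      using C1[OF z] C2[OF z] C3[OF z] C4[OF z] mu_pos by linarith+
  qed
qed

lemma coercivity_constant:
  obtains \<alpha> where "\<alpha> > 0" "\<alpha> \<le> \<mu>" "\<And>z. z \<in> \<Omega> \<Longrightarrow> \<alpha> \<le> Dx z" "\<And>z. z \<in> \<Omega> \<Longrightarrow> \<alpha> \<le> Dy z"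
proof -
  obtain \<delta>1 where 1: "\<delta>1 > 0" "\<forall>z\<in>\<Omega>. \<delta>1 \<le> Dx z" using Dx_pos unfolding bounded_below_def by blast
  obtain \<delta>2 where 2: "\<delta>2 > 0" "\<forall>z\<in>\<Omega>. \<delta>2 \<le> Dy z" using Dy_pos unfolding bounded_below_def by blast
  show ?thesis
  proof (rule that[of "min \<mu> (min \<delta>1 \<delta>2)"])
    show "min \<mu> (min \<delta>1 \<delta>2) > 0" "min \<mu> (min \<delta>1 \<delta>2) \<le> \<mu>"
      using 1 2 mu_pos by simp_all
    fix z assume "z \<in> \<Omega>"
    then show "min \<mu> (min \<delta>1 \<delta>2) \<le> Dx z" "min \<mu> (min \<delta>1 \<delta>2) \<le> Dy z"
      using 1(2) 2(2) by (simp_all add: min_le_iff_disj)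
  qed
qed

section \<open>Vanishing of the convection term\<close>

lemma integrable_convection:
  "f \<in> sobolev \<Omega> 1 \<Longrightarrow> integrable (lebesgue_on \<Omega>) (convection f)"
  unfolding convection_def by (rule integrable_terms(3))

lemma convection_test_function:
  assumes \<phi>: "\<phi> \<in> test_functions \<Omega>"
  shows "integral\<^sup>L (lebesgue_on \<Omega>) (convection \<phi>) = 0"
proof -
  note C1 = test_functions_Ck[OF \<phi>, of "Suc 0"]
  have "2 * integral\<^sup>L (lebesgue_on \<Omega>) (convection \<phi>)
      = (\<integral>z. 2 * convection \<phi> z \<partial>lebesgue_on \<Omega>)"
    by simp
  also have "\<dots> = (\<integral>z. u z * dx (\<lambda>z. \<phi> z * \<phi> z) z + v z * dy (\<lambda>z. \<phi> z * \<phi> z) z \<partial>lebesgue_on \<Omega>)"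
  proof (rule integral_cong_AE)
    show "AE z in lebesgue_on \<Omega>. 2 * convection \<phi> z
        = u z * dx (\<lambda>z. \<phi> z * \<phi> z) z + v z * dy (\<lambda>z. \<phi> z * \<phi> z) z"
      using wdx_wdy_test_function_AE[OF open_domain \<phi>]
    proof eventually_elim
      case (elim z)
      show ?case
        unfolding convection_def conjunct1[OF elim] conjunct2[OF elim] dx_mult[OF C1 C1] dy_mult[OF C1 C1]
        by (simp add: algebra_simps)
    qed
    show "(\<lambda>z. 2 * convection \<phi> z) \<in> borel_measurable (lebesgue_on \<Omega>)"
      by (intro borel_measurable_integrable integrable_mult_right integrable_convection
          test_functions_sobolev open_domain \<phi>)
    have uv: "u \<in> borel_measurable (lebesgue_on \<Omega>)" "v \<in> borel_measurable (lebesgue_on \<Omega>)"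
      using u v by (simp_all add: bounded_coeff_def)
    have m: "\<psi> \<in> borel_measurable (lebesgue_on \<Omega>)" if "\<psi> \<in> test_functions \<Omega>" for \<psi>
      by (rule L2_D(1)[OF test_functions_L2[OF open_domain that]])
    show "(\<lambda>z. u z * dx (\<lambda>z. \<phi> z * \<phi> z) z + v z * dy (\<lambda>z. \<phi> z * \<phi> z) z)
        \<in> borel_measurable (lebesgue_on \<Omega>)"
      by (intro borel_measurable_add borel_measurable_times[OF uv(1) m] borel_measurable_times[OF uv(2) m]
          test_functions_dx test_functions_dy test_functions_mult \<phi>)
  qed
  also have "\<dots> = 0"
    using div_free test_functions_mult[OF \<phi> \<phi>] unfolding divergence_free_def by (rule bspec)
  finally show ?thesis by simp
qed

text \<open>Here \<open>e0, e1, e2\<close> are value and gradient of \<open>e\<close>, and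
  \<open>r0, r1, r2\<close> those of the approximation error. Every product left in the difference
  contains some \<open>r\<close>; the small weight falls on the \<open>e\<close> squares, and the
  large factor 1/\<epsilon> only on the \<open>r\<close> squares, whose integral will be at most
  \<epsilon> squared.\<close>

lemma convection_diff_bound:
  fixes e0 e1 e2 r0 r1 r2 a b B \<epsilon> :: real
  assumes a: "\<bar>a\<bar> \<le> B" and b: "\<bar>b\<bar> \<le> B" and \<epsilon>: "0 < \<epsilon>"
  shows "\<bar>e0 * (a * e1 + b * e2) - (e0 + r0) * (a * (e1 + r1) + b * (e2 + r2))\<bar>
    \<le> B * (2 * \<epsilon> * (e0\<^sup>2 + e1\<^sup>2 + e2\<^sup>2) + (1 / (2 * \<epsilon>) + 1) * (r0\<^sup>2 + r1\<^sup>2 + r2\<^sup>2))"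
proof -
  have B: "B \<ge> 0" using a by linarith
  let ?S = "\<bar>e0\<bar> * \<bar>r1\<bar> + \<bar>e0\<bar> * \<bar>r2\<bar> + \<bar>e1\<bar> * \<bar>r0\<bar> + \<bar>e2\<bar> * \<bar>r0\<bar> + \<bar>r0\<bar> * \<bar>r1\<bar> + \<bar>r0\<bar> * \<bar>r2\<bar>"
  have t: "\<bar>k * (x * y)\<bar> \<le> B * (\<bar>x\<bar> * \<bar>y\<bar>)" if "\<bar>k\<bar> \<le> B" for k x y
    unfolding abs_mult by (rule mult_right_mono[OF that]) simp
  have "e0 * (a * e1 + b * e2) - (e0 + r0) * (a * (e1 + r1) + b * (e2 + r2))
      = - (a * (e0 * r1) + b * (e0 * r2) + a * (e1 * r0) + b * (e2 * r0) + a * (r0 * r1) + b * (r0 * r2))"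
    by (simp add: algebra_simps)
  moreover have "\<bar>a * (e0 * r1) + b * (e0 * r2) + a * (e1 * r0) + b * (e2 * r0) + a * (r0 * r1) + b * (r0 * r2)\<bar>
      \<le> B * (\<bar>e0\<bar> * \<bar>r1\<bar>) + B * (\<bar>e0\<bar> * \<bar>r2\<bar>) + B * (\<bar>e1\<bar> * \<bar>r0\<bar>)
        + B * (\<bar>e2\<bar> * \<bar>r0\<bar>) + B * (\<bar>r0\<bar> * \<bar>r1\<bar>) + B * (\<bar>r0\<bar> * \<bar>r2\<bar>)"
    by (intro order_trans[OF abs_triangle_ineq add_mono] t a b)
  ultimately have "\<bar>e0 * (a * e1 + b * e2) - (e0 + r0) * (a * (e1 + r1) + b * (e2 + r2))\<bar> \<le> B * ?S"
    by (simp only: abs_minus_cancel distrib_left)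
  also have "B * ?S \<le> B * (2 * \<epsilon> * (e0\<^sup>2 + e1\<^sup>2 + e2\<^sup>2) + (1 / (2 * \<epsilon>) + 1) * (r0\<^sup>2 + r1\<^sup>2 + r2\<^sup>2))"
  proof (rule mult_left_mono[OF _ B])
    note w = abs_mult_le_weighted_squares
    have w': "\<bar>x\<bar> * \<bar>y\<bar> \<le> x\<^sup>2 / 2 + y\<^sup>2 / 2" for x y :: real
      using w[of "1 / 2" x y] by simp
    have q: "(1 / (2 * \<epsilon>) + 1) * x = 2 * (x / (4 * \<epsilon>)) + x" for x
      using \<epsilon> by (simp add: field_simps)
    have p: "0 \<le> \<epsilon> * x\<^sup>2" "0 \<le> x\<^sup>2 / (4 * \<epsilon>)" "0 \<le> x\<^sup>2" for x
      using \<epsilon> by simp_all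
    \<comment> \<open>Young's weight is \<epsilon> for the four mixed products and 1/2 for the two
      products of errors. The next step raises all multiplicities to a common value, so that full H1
      densities appear.\<close>
    have "?S \<le> 2 * (\<epsilon> * e0\<^sup>2) + \<epsilon> * e1\<^sup>2 + \<epsilon> * e2\<^sup>2
        + (2 * (r0\<^sup>2 / (4 * \<epsilon>)) + r1\<^sup>2 / (4 * \<epsilon>) + r2\<^sup>2 / (4 * \<epsilon>))
        + (r0\<^sup>2 + r1\<^sup>2 + r2\<^sup>2)"
      using w[OF \<epsilon>, of e0 r1] w[OF \<epsilon>, of e0 r2] w[OF \<epsilon>, of e1 r0] w[OF \<epsilon>, of e2 r0]
        w'[of r0 r1] w'[of r0 r2] p(3)[of r1] p(3)[of r2] by linarith
    also have "\<dots> \<le> 2 * (\<epsilon> * e0\<^sup>2) + 2 * (\<epsilon> * e1\<^sup>2) + 2 * (\<epsilon> * e2\<^sup>2)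
        + ((2 * (r0\<^sup>2 / (4 * \<epsilon>)) + r0\<^sup>2) + (2 * (r1\<^sup>2 / (4 * \<epsilon>)) + r1\<^sup>2)
        + (2 * (r2\<^sup>2 / (4 * \<epsilon>)) + r2\<^sup>2))"
      using p(1)[of e1] p(1)[of e2] p(2)[of r1] p(2)[of r2] by linarith
    also have "\<dots> = 2 * \<epsilon> * (e0\<^sup>2 + e1\<^sup>2 + e2\<^sup>2) + (1 / (2 * \<epsilon>) + 1) * (r0\<^sup>2 + r1\<^sup>2 + r2\<^sup>2)"
      unfolding distrib_left[of "1 / (2 * \<epsilon>) + 1"]
      unfolding q by (simp only: distrib_left mult.assoc add.assoc)
    finally show "?S \<le> 2 * \<epsilon> * (e0\<^sup>2 + e1\<^sup>2 + e2\<^sup>2) + (1 / (2 * \<epsilon>) + 1) * (r0\<^sup>2 + r1\<^sup>2 + r2\<^sup>2)" .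
  qed
  finally show ?thesis .
qed

lemma convection_sobolev0:
  assumes e: "e \<in> sobolev0 \<Omega>"
  shows "integral\<^sup>L (lebesgue_on \<Omega>) (convection e) = 0"
proof -
  note e1 = sobolev0_imp_sobolev[OF e]
  let ?I = "integral\<^sup>L (lebesgue_on \<Omega>)"
  obtain B where B: "B > 0" "\<And>z. z \<in> \<Omega> \<Longrightarrow> \<bar>u z\<bar> \<le> B" "\<And>z. z \<in> \<Omega> \<Longrightarrow> \<bar>v z\<bar> \<le> B"
    by (rule coefficient_bound) (rule that)
  let ?E = "?I (h1_density \<Omega> e)"
  \<comment> \<open>The error part contributes (1/(2\<epsilon>) + 1) \<epsilon>^2 = \<epsilon> (1/2
    + \<epsilon>), and 1/2 + \<epsilon> is at most the final summand 2 because \<epsilon> <=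
    1.\<close>
  have "\<bar>?I (convection e)\<bar> \<le> \<epsilon> * (B * (2 * ?E + 2))" if \<epsilon>: "0 < \<epsilon>" "\<epsilon> \<le> 1" for \<epsilon>
  proof -
    obtain \<phi> where \<phi>: "\<phi> \<in> test_functions \<Omega>" "sobolev_norm \<Omega> 1 (\<lambda>z. \<phi> z - e z) < \<epsilon>"
      using e \<epsilon>(1) by (rule sobolev0_approx)
    note \<phi>1 = test_functions_sobolev[OF open_domain \<phi>(1)]
    note \<phi>e = sobolev_diff[OF open_domain \<phi>1 e1]
    let ?R = "?I (h1_density \<Omega> (\<lambda>z. \<phi> z - e z))"
    have R: "?R \<le> \<epsilon>\<^sup>2"
      using power_mono[OF less_imp_le[OF \<phi>(2)] sobolev_norm_nonneg, of 2]
      by (simp only: sobolev_norm_1_power2[OF open_domain \<phi>e])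
    let ?D = "\<lambda>z. B * (2 * \<epsilon> * h1_density \<Omega> e z + (1 / (2 * \<epsilon>) + 1) * h1_density \<Omega> (\<lambda>z. \<phi> z - e z) z)"
    have intD: "integrable (lebesgue_on \<Omega>) ?D"
      by (intro integrable_mult_right Bochner_Integration.integrable_add
          integrable_h1_density[OF open_domain] e1 \<phi>e)
    have intc: "integrable (lebesgue_on \<Omega>) (\<lambda>z. convection e z - convection \<phi> z)"
      by (intro Bochner_Integration.integrable_diff integrable_convection e1 \<phi>1)
    have "?I (convection e) = (\<integral>z. convection e z - convection \<phi> z \<partial>lebesgue_on \<Omega>)"
      using integrable_convection[OF e1] integrable_convection[OF \<phi>1] convection_test_function[OF \<phi>(1)]
      by simp
    then have "\<bar>?I (convection e)\<bar> \<le> (\<integral>z. \<bar>convection e z - convection \<phi> z\<bar> \<partial>lebesgue_on \<Omega>)"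
      by (simp only: integral_abs_bound)
    also have "\<dots> \<le> ?I ?D"
    proof (rule integral_mono_AE[OF integrable_abs[OF intc] intD])
      have "AE z in lebesgue_on \<Omega>. z \<in> \<Omega>"
        by (rule AE_I2) (simp add: space_restrict_space)
      then show "AE z in lebesgue_on \<Omega>. \<bar>convection e z - convection \<phi> z\<bar> \<le> ?D z"
        using wdx_wdy_diff_AE[OF open_domain \<phi>1 e1]
      proof eventually_elim
        case (elim z)
        have eq: "\<phi> z = e z + (\<phi> z - e z)" "wdx \<Omega> \<phi> z = wdx \<Omega> e z + wdx \<Omega> (\<lambda>z. \<phi> z - e z) z"
          "wdy \<Omega> \<phi> z = wdy \<Omega> e z + wdy \<Omega> (\<lambda>z. \<phi> z - e z) z"
          using elim(2) by simp_all
        have "\<bar>convection e z - convection \<phi> z\<bar>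
          = \<bar>e z * (u z * wdx \<Omega> e z + v z * wdy \<Omega> e z) - (e z + (\<phi> z - e z))
            * (u z * (wdx \<Omega> e z + wdx \<Omega> (\<lambda>z. \<phi> z - e z) z) + v z * (wdy \<Omega> e z + wdy \<Omega> (\<lambda>z. \<phi> z - e z) z))\<bar>"
          by (simp only: convection_def eq(1)[symmetric] eq(2,3)[symmetric])
        also have "\<dots> \<le> ?D z"
          unfolding h1_density_def
          by (rule convection_diff_bound[OF B(2)[OF elim(1)] B(3)[OF elim(1)] \<epsilon>(1)])
        finally show ?case .
      qed
    qed
    also have "?I ?D = B * (2 * \<epsilon> * ?E + (1 / (2 * \<epsilon>) + 1) * ?R)"
      using integrable_h1_density[OF open_domain e1] integrable_h1_density[OF open_domain \<phi>e]
      by simp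
    also have "\<dots> \<le> B * (2 * \<epsilon> * ?E + (1 / (2 * \<epsilon>) + 1) * \<epsilon>\<^sup>2)"
      using B(1) \<epsilon>(1) R by (intro mult_left_mono add_left_mono) auto
    also have "(1 / (2 * \<epsilon>) + 1) * \<epsilon>\<^sup>2 = \<epsilon> * (1 / 2 + \<epsilon>)"
      using \<epsilon>(1) by (simp add: field_simps power2_eq_square)
    also have "B * (2 * \<epsilon> * ?E + \<epsilon> * (1 / 2 + \<epsilon>)) = \<epsilon> * (B * (2 * ?E + (1 / 2 + \<epsilon>)))"
      by (simp add: algebra_simps)
    also have "\<dots> \<le> \<epsilon> * (B * (2 * ?E + 2))"
      using B(1) \<epsilon> by (intro mult_left_mono add_left_mono) auto
    finally show ?thesis .
  qed
  then have "\<bar>?I (convection e)\<bar> \<le> 0"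
    by (rule real_le_0_if_le_small_multiples)
  then show ?thesis by simp
qed

text \<open>Subtracting the convection density does not change the integral of
  \<open>form_density e e\<close>, and what remains is a weighted sum of the three squares in
  \<open>h1_density\<close> with weights at least \<alpha>.\<close>

lemma form_coercive:
  assumes e: "e \<in> sobolev0 \<Omega>"
    and \<alpha>: "\<alpha> \<le> \<mu>" "\<And>z. z \<in> \<Omega> \<Longrightarrow> \<alpha> \<le> Dx z" "\<And>z. z \<in> \<Omega> \<Longrightarrow> \<alpha> \<le> Dy z"
  shows "\<alpha> * (sobolev_norm \<Omega> 1 e)\<^sup>2 \<le> form e e"
proof -
  note e1 = sobolev0_imp_sobolev[OF e]
  let ?I = "integral\<^sup>L (lebesgue_on \<Omega>)"
  have "\<alpha> * ?I (h1_density \<Omega> e) = (\<integral>z. \<alpha> * h1_density \<Omega> e z \<partial>lebesgue_on \<Omega>)"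
    by simp
  also have "\<dots> \<le> (\<integral>z. form_density e e z - convection e z \<partial>lebesgue_on \<Omega>)"
  proof (rule integral_mono)
    fix z assume "z \<in> space (lebesgue_on \<Omega>)"
    then have z: "z \<in> \<Omega>" by (simp add: space_restrict_space)
    have "\<alpha> * h1_density \<Omega> e z = \<alpha> * (e z)\<^sup>2 + \<alpha> * (wdx \<Omega> e z)\<^sup>2 + \<alpha> * (wdy \<Omega> e z)\<^sup>2"
      unfolding h1_density_def by (simp only: distrib_left)
    also have "\<dots> \<le> \<mu> * (e z)\<^sup>2 + Dx z * (wdx \<Omega> e z)\<^sup>2 + Dy z * (wdy \<Omega> e z)\<^sup>2"
      by (intro add_mono mult_right_mono zero_le_power2 \<alpha> z)
    also have "\<dots> = form_density e e z - convection e z"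
      unfolding form_density_def convection_def by (simp add: power2_eq_square)
    finally show "\<alpha> * h1_density \<Omega> e z \<le> form_density e e z - convection e z" .
  qed (intro integrable_mult_right Bochner_Integration.integrable_diff integrable_form_density
      integrable_convection integrable_h1_density open_domain e1)+
  also have "\<dots> = form e e"
    using integrable_form_density[OF e1 e1] integrable_convection[OF e1] convection_sobolev0[OF e]
    by (simp add: form_eq_integral e1 del: One_nat_def)
  finally show ?thesis
    by (simp only: sobolev_norm_1_power2[OF open_domain e1])
qed

text \<open>Young's inequality is applied to each of the five products of the density. Each
  derivative of \<open>e\<close> occurs in two of them (diffusion and convection) and
  \<open>w\<close> itself in three, whence the factors 2 and 3.\<close>

lemma form_le_weighted_squares:
  assumes e: "e \<in> sobolev \<Omega> 1" and w: "w \<in> sobolev \<Omega> 1" and t: "t > 0"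
    and B: "\<mu> \<le> B" "\<And>z. z \<in> \<Omega> \<Longrightarrow> \<bar>Dx z\<bar> \<le> B" "\<And>z. z \<in> \<Omega> \<Longrightarrow> \<bar>Dy z\<bar> \<le> B"
      "\<And>z. z \<in> \<Omega> \<Longrightarrow> \<bar>u z\<bar> \<le> B" "\<And>z. z \<in> \<Omega> \<Longrightarrow> \<bar>v z\<bar> \<le> B"
  shows "form e w \<le> B * (2 * t * (sobolev_norm \<Omega> 1 e)\<^sup>2 + 3 / (4 * t) * (sobolev_norm \<Omega> 1 w)\<^sup>2)"
proof -
  have "integral\<^sup>L (lebesgue_on \<Omega>) (form_density e w)
      \<le> (\<integral>z. B * (2 * t * h1_density \<Omega> e z + 3 / (4 * t) * h1_density \<Omega> w z) \<partial>lebesgue_on \<Omega>)"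
  proof (rule integral_mono)
    fix z assume "z \<in> space (lebesgue_on \<Omega>)"
    then have z: "z \<in> \<Omega>" by (simp add: space_restrict_space)
    have B0: "B \<ge> 0" using B(1) mu_pos by linarith
    have k: "k * (x * y) \<le> B * (t * x\<^sup>2 + y\<^sup>2 / (4 * t))" if "\<bar>k\<bar> \<le> B" for k x y
    proof -
      have "k * (x * y) \<le> \<bar>k\<bar> * (\<bar>x\<bar> * \<bar>y\<bar>)"
        unfolding abs_mult[symmetric] by (rule abs_ge_self)
      also have "\<dots> \<le> B * (t * x\<^sup>2 + y\<^sup>2 / (4 * t))"
        by (intro mult_mono that abs_mult_le_weighted_squares t B0) simp
      finally show ?thesis .
    qed
    have p: "0 \<le> t * x\<^sup>2" "0 \<le> x\<^sup>2 / (4 * t)" for x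
      using t by simp_all
    have "form_density e w z = Dx z * (wdx \<Omega> e z * wdx \<Omega> w z) + Dy z * (wdy \<Omega> e z * wdy \<Omega> w z)
        + u z * (wdx \<Omega> e z * w z) + v z * (wdy \<Omega> e z * w z) + \<mu> * (e z * w z)"
      unfolding form_density_def by (simp add: algebra_simps)
    also have "\<dots> \<le> B * (t * (wdx \<Omega> e z)\<^sup>2 + (wdx \<Omega> w z)\<^sup>2 / (4 * t))
        + B * (t * (wdy \<Omega> e z)\<^sup>2 + (wdy \<Omega> w z)\<^sup>2 / (4 * t))
        + B * (t * (wdx \<Omega> e z)\<^sup>2 + (w z)\<^sup>2 / (4 * t))
        + B * (t * (wdy \<Omega> e z)\<^sup>2 + (w z)\<^sup>2 / (4 * t))
        + B * (t * (e z)\<^sup>2 + (w z)\<^sup>2 / (4 * t))"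
      using B(1) mu_pos by (intro add_mono k B(2-5) z) simp
    also have "\<dots> = B * (2 * (t * (wdx \<Omega> e z)\<^sup>2) + 2 * (t * (wdy \<Omega> e z)\<^sup>2) + t * (e z)\<^sup>2
        + (3 * ((w z)\<^sup>2 / (4 * t)) + (wdx \<Omega> w z)\<^sup>2 / (4 * t) + (wdy \<Omega> w z)\<^sup>2 / (4 * t)))"
      by (simp add: algebra_simps)
    also have "\<dots> \<le> B * (2 * (t * (wdx \<Omega> e z)\<^sup>2) + 2 * (t * (wdy \<Omega> e z)\<^sup>2) + 2 * (t * (e z)\<^sup>2)
        + (3 * ((w z)\<^sup>2 / (4 * t)) + 3 * ((wdx \<Omega> w z)\<^sup>2 / (4 * t)) + 3 * ((wdy \<Omega> w z)\<^sup>2 / (4 * t))))"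
      using p(1)[of "e z"] p(2)[of "wdx \<Omega> w z"] p(2)[of "wdy \<Omega> w z"]
      by (intro mult_left_mono[OF _ B0]) linarith
    also have "\<dots> = B * (2 * t * h1_density \<Omega> e z + 3 / (4 * t) * h1_density \<Omega> w z)"
      unfolding h1_density_def by (simp add: algebra_simps)
    finally show "form_density e w z \<le> B * (2 * t * h1_density \<Omega> e z + 3 / (4 * t) * h1_density \<Omega> w z)" .
  qed (intro integrable_mult_right Bochner_Integration.integrable_add integrable_form_density
      integrable_h1_density open_domain e w)+
  then show ?thesis
    using integrable_h1_density[OF open_domain e] integrable_h1_density[OF open_domain w]
    by (simp add: form_eq_integral sobolev_norm_1_power2 open_domain e w del: One_nat_def)
qed

text \<open>Young's inequality with weight \<open>\<alpha> / (4 B)\<close> absorbs half of the energy of \<open>e\<close>, so that no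
  Cauchy-Schwarz inequality is needed.\<close>

lemma quasi_optimality:
  obtains M where "M > 0" "\<And>e w. e \<in> sobolev0 \<Omega> \<Longrightarrow> w \<in> sobolev \<Omega> 1 \<Longrightarrow> form e e = form e w \<Longrightarrow>
    energy_norm \<Omega> Dx Dy u v \<mu> e \<le> M * sobolev_norm \<Omega> 1 w"
proof -
  obtain B where B: "B > 0" "\<mu> \<le> B" "\<And>z. z \<in> \<Omega> \<Longrightarrow> \<bar>Dx z\<bar> \<le> B" "\<And>z. z \<in> \<Omega> \<Longrightarrow> \<bar>Dy z\<bar> \<le> B"
    "\<And>z. z \<in> \<Omega> \<Longrightarrow> \<bar>u z\<bar> \<le> B" "\<And>z. z \<in> \<Omega> \<Longrightarrow> \<bar>v z\<bar> \<le> B"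
    by (rule coefficient_bound) (rule that)
  obtain \<alpha> where \<alpha>: "\<alpha> > 0" "\<alpha> \<le> \<mu>" "\<And>z. z \<in> \<Omega> \<Longrightarrow> \<alpha> \<le> Dx z" "\<And>z. z \<in> \<Omega> \<Longrightarrow> \<alpha> \<le> Dy z"
    by (rule coercivity_constant) (rule that)
  \<comment> \<open>With t = \<alpha>/(4 B) the two coefficients of the upper bound are 2 t B =
    \<alpha>/2 and 3 B/(4 t) = 3 B^2/\<alpha>, the latter being half of \<open>M2\<close>.\<close>
  define M2 where "M2 = 6 * B\<^sup>2 / \<alpha>"
  have M2: "M2 > 0"
    using B(1) \<alpha>(1) by (simp add: M2_def)
  show ?thesis
  proof (rule that[of "sqrt M2"])
    show "sqrt M2 > 0" using M2 by simp
    fix e w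
    assume e: "e \<in> sobolev0 \<Omega>" and w: "w \<in> sobolev \<Omega> 1" and eq: "form e e = form e w"
    let ?t = "\<alpha> / (4 * B)"
    have t: "?t > 0" using B(1) \<alpha>(1) by simp
    have "form e e \<le> B * (2 * ?t * (sobolev_norm \<Omega> 1 e)\<^sup>2 + 3 / (4 * ?t) * (sobolev_norm \<Omega> 1 w)\<^sup>2)"
      unfolding eq by (rule form_le_weighted_squares[OF sobolev0_imp_sobolev[OF e] w t B(2-6)])
    also have "\<dots> = \<alpha> * (sobolev_norm \<Omega> 1 e)\<^sup>2 / 2 + M2 * (sobolev_norm \<Omega> 1 w)\<^sup>2 / 2"
      using B(1) \<alpha>(1) by (simp add: M2_def field_simps power2_eq_square)
    also have "\<dots> \<le> form e e / 2 + M2 * (sobolev_norm \<Omega> 1 w)\<^sup>2 / 2"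
      using form_coercive[OF e \<alpha>(2-4)] by simp
    finally have "form e e \<le> M2 * (sobolev_norm \<Omega> 1 w)\<^sup>2"
      by simp
    then have "sqrt (form e e) \<le> sqrt (M2 * (sobolev_norm \<Omega> 1 w)\<^sup>2)"
      by (rule real_sqrt_le_mono)
    then show "energy_norm \<Omega> Dx Dy u v \<mu> e \<le> sqrt M2 * sobolev_norm \<Omega> 1 w"
      by (simp add: energy_norm_def real_sqrt_mult sobolev_norm_nonneg)
  qed
qed

text \<open>The test function for orthogonality is \<open>ch - w\<close>, a member of
  \<open>Vh\<close> and hence admissible in both equations. All that matters about \<open>l\<close>
  is that both share it, so it cancels; then a(e, ch) = a(e, w), and a(e, c) is subtracted from both
  sides.\<close>

lemma galerkin_error_identity:
  assumes V: "Vh \<subseteq> sobolev0 \<Omega>" and c: "c \<in> sobolev0 \<Omega>" and ch: "ch \<in> Vh" and w: "w \<in> Vh"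
    and dh: "(\<lambda>z. ch z - w z) \<in> Vh"
    and weak: "\<And>d. d \<in> sobolev0 \<Omega> \<Longrightarrow> form c d = l d"
    and galerkin: "\<And>d. d \<in> Vh \<Longrightarrow> form ch d = l d"
  shows "form (\<lambda>z. ch z - c z) (\<lambda>z. ch z - c z) = form (\<lambda>z. ch z - c z) (\<lambda>z. w z - c z)"
proof -
  note H1 = sobolev0_imp_sobolev
  have s: "ch \<in> sobolev \<Omega> 1" "c \<in> sobolev \<Omega> 1" "w \<in> sobolev \<Omega> 1" "(\<lambda>z. ch z - w z) \<in> sobolev \<Omega> 1"
    by (rule H1 subsetD[OF V] c ch w dh)+
  note d = sobolev_diff[OF open_domain]
  have "form (\<lambda>z. ch z - c z) (\<lambda>z. ch z - w z) = form ch (\<lambda>z. ch z - w z) - form c (\<lambda>z. ch z - w z)"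
    by (rule form_diff_left[OF s(1,2,4)])
  also have "\<dots> = 0"
    using galerkin[OF dh] weak[OF subsetD[OF V dh]] by simp
  finally have "form (\<lambda>z. ch z - c z) ch = form (\<lambda>z. ch z - c z) w"
    using form_diff_right[OF s(1,3) d[OF s(1,2)]] by simp
  then show ?thesis
    using form_diff_right[OF s(1,2) d[OF s(1,2)]] form_diff_right[OF s(3,2) d[OF s(1,2)]] by simp
qed

end

section \<open>Discrete spaces, mesh size and the final estimate\<close>

lemma fin_dim_subspace_lincomb:
  assumes V: "fin_dim_subspace Vh V" and fg: "f \<in> Vh" "g \<in> Vh"
  shows "(\<lambda>z. s * f z + t * g z) \<in> Vh"
proof -
  obtain n :: nat and \<psi> where Vh: "Vh = {(\<lambda>z. \<Sum>i<n. a i * \<psi> i z) | a. True}"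
    using V unfolding fin_dim_subspace_def by (elim conjE exE)
  obtain a where f: "f = (\<lambda>z. \<Sum>i<n. a i * \<psi> i z)"
    using fg(1) unfolding Vh mem_Collect_eq by (elim exE conjE)
  obtain b where g: "g = (\<lambda>z. \<Sum>i<n. b i * \<psi> i z)"
    using fg(2) unfolding Vh mem_Collect_eq by (elim exE conjE)
  have "(\<lambda>z. s * f z + t * g z) = (\<lambda>z. \<Sum>i<n. (s * a i + t * b i) * \<psi> i z)"
    unfolding f g by (simp add: sum_distrib_left sum.distrib algebra_simps)
  then show ?thesis
    unfolding Vh mem_Collect_eq by (intro exI[of _ "\<lambda>i. s * a i + t * b i"]) simp
qed

lemma fin_dim_subspace_sum:
  fixes N :: nat
  assumes V: "fin_dim_subspace Vh V" and zero: "g \<in> Vh" and \<phi>: "\<And>i. i < N \<Longrightarrow> \<phi> i \<in> Vh"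
  shows "(\<lambda>z. \<Sum>i<N. a i * \<phi> i z) \<in> Vh"
  using \<phi>
proof (induction N)
  \<comment> \<open>The empty sum is the zero function, obtained from the given member as
    \<open>0 * g z + 0 * g z\<close>.\<close>
  case 0
  show ?case
    using fin_dim_subspace_lincomb[OF V zero zero, of 0 0] by simp
next
  case (Suc N)
  have "(\<lambda>z. \<Sum>i<N. a i * \<phi> i z) \<in> Vh"
    using Suc.prems by (intro Suc.IH) simp
  from fin_dim_subspace_lincomb[OF V this Suc.prems[OF lessI], of 1 "a N"] show ?case
    by simp
qed

text \<open>This allows the interpolation constant to be enlarged in front of the power of the mesh
  size. At least one element makes the maximum attained, and boundedness of \<Omega> makes its
  diameter nonnegative.\<close>

lemma mesh_size_nonneg:
  assumes "bounded \<Omega>" "mesh \<Omega> nel K"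
  shows "0 \<le> mesh_size nel K"
proof -
  have "mesh_size nel K \<in> (\<lambda>k. diameter (K k)) ` {1..nel}"
    unfolding mesh_size_def using assms by (intro Max_in) (auto simp: mesh_def)
  then obtain k where k: "k \<in> {1..nel}" "mesh_size nel K = diameter (K k)"
    by blast
  have "K k \<subseteq> \<Omega>"
    using assms(2) k(1) by (simp add: mesh_def)
  then have "bounded (K k)"
    by (rule bounded_subset[OF assms(1)])
  then show ?thesis
    unfolding k(2) by (rule diameter_ge_0)
qed

theorem mainTheorem1:
  fixes \<Omega> :: "(real \<times> real) set"
    and Dx Dy u v :: "real \<times> real \<Rightarrow> real"
    and \<mu> Cbar :: real
    and p :: nat
  assumes "bounded_domain \<Omega>"
    and "bounded_coeff \<Omega> Dx" and "bounded_coeff \<Omega> Dy"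
    and "bounded_coeff \<Omega> u" and "bounded_coeff \<Omega> v"
    and "bounded_below \<Omega> Dx" and "bounded_below \<Omega> Dy"
    and "divergence_free \<Omega> u v"
    and "\<mu> > 0"
    and "p \<ge> 1"
  shows "\<exists>C'>0. \<forall>(nel::nat) K Vh (N::nat) \<xi> \<phi> q c ch (r::nat).
           mesh \<Omega> nel K
           \<and> fin_dim_subspace Vh (sobolev0 \<Omega>)
           \<and> nodal_shape_functions \<Omega> Vh N \<xi> \<phi>
           \<and> interpolation_estimate \<Omega> p Cbar (mesh_size nel K) N \<xi> \<phi>
           \<and> q \<in> L2 \<Omega>
           \<and> c \<in> sobolev0 \<Omega> \<and> (\<forall>d\<in>sobolev0 \<Omega>. adr_form \<Omega> Dx Dy u v \<mu> c d = load \<Omega> q d)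
           \<and> ch \<in> Vh \<and> (\<forall>dh\<in>Vh. adr_form \<Omega> Dx Dy u v \<mu> ch dh = load \<Omega> q dh)
           \<and> r \<ge> p + 1 \<and> c \<in> sobolev \<Omega> r
           \<longrightarrow> energy_norm \<Omega> Dx Dy u v \<mu> (\<lambda>z. ch z - c z)
               \<le> C' * mesh_size nel K ^ p * sobolev_norm \<Omega> (p + 1) c"
proof -
  interpret adr_problem \<Omega> Dx Dy u v \<mu>
    using assms by unfold_locales (simp_all add: bounded_domain_def)
  obtain M where M: "M > 0" "\<And>e w. e \<in> sobolev0 \<Omega> \<Longrightarrow> w \<in> sobolev \<Omega> 1 \<Longrightarrow>
      form e e = form e w \<Longrightarrow> energy_norm \<Omega> Dx Dy u v \<mu> e \<le> M * sobolev_norm \<Omega> 1 w"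
    by (rule quasi_optimality) (rule that)
  \<comment> \<open>\<open>Cbar\<close> is an arbitrary real; passing to
    \<open>\<bar>Cbar\<bar> + 1\<close> guarantees a positive constant that still dominates
    it.\<close>
  let ?C = "M * (\<bar>Cbar\<bar> + 1)"
  show ?thesis
  proof (intro exI[of _ ?C] conjI allI impI; (elim conjE)?)
    show "?C > 0"
      using M(1) by (intro mult_pos_pos) linarith+
    fix nel N r :: nat and K Vh \<xi> \<phi> q c ch
    assume mesh: "mesh \<Omega> nel K" and V: "fin_dim_subspace Vh (sobolev0 \<Omega>)"
      and nodal: "nodal_shape_functions \<Omega> Vh N \<xi> \<phi>"
      and interp: "interpolation_estimate \<Omega> p Cbar (mesh_size nel K) N \<xi> \<phi>"
      and c: "c \<in> sobolev0 \<Omega>" and weak: "\<forall>d\<in>sobolev0 \<Omega>. form c d = load \<Omega> q d"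
      and ch: "ch \<in> Vh" and galerkin: "\<forall>dh\<in>Vh. form ch dh = load \<Omega> q dh"
      and r: "r \<ge> p + 1" and cr: "c \<in> sobolev \<Omega> r"
    let ?h = "mesh_size nel K"
    let ?w = "nodal_interpolant \<Omega> N \<xi> \<phi> c"
    have Vh: "Vh \<subseteq> sobolev0 \<Omega>"
      using V by (simp add: fin_dim_subspace_def)
    have w: "?w \<in> Vh"
      unfolding nodal_interpolant_def
      by (rule fin_dim_subspace_sum[OF V ch]) (use nodal in \<open>simp add: nodal_shape_functions_def\<close>)
    have dh: "(\<lambda>z. ch z - ?w z) \<in> Vh"
      using fin_dim_subspace_lincomb[OF V ch w, of 1 "-1"] by simp
    have "form (\<lambda>z. ch z - c z) (\<lambda>z. ch z - c z) = form (\<lambda>z. ch z - c z) (\<lambda>z. ?w z - c z)"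
      by (rule galerkin_error_identity[OF Vh c ch w dh, where l = "load \<Omega> q"])
        (rule bspec[OF weak] bspec[OF galerkin], assumption)+
    then have "energy_norm \<Omega> Dx Dy u v \<mu> (\<lambda>z. ch z - c z)
        \<le> M * sobolev_norm \<Omega> 1 (\<lambda>z. ?w z - c z)"
      by (intro M(2) sobolev0_diff sobolev_diff open_domain c sobolev0_imp_sobolev
          subsetD[OF Vh ch] subsetD[OF Vh w])
    \<comment> \<open>The regularity \<open>r\<close> enters only through the inclusion of
      \<open>sobolev \<Omega> r\<close> in \<open>sobolev \<Omega> (p + 1)\<close>, which makes the
      interpolation estimate applicable to \<open>c\<close>.\<close>
    also have "sobolev_norm \<Omega> 1 (\<lambda>z. ?w z - c z) \<le> Cbar * ?h ^ p * sobolev_norm \<Omega> (p + 1) c"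
      using interp c subsetD[OF sobolev_antimono[OF r] cr]
      unfolding interpolation_estimate_def by blast
    also have "\<dots> \<le> (\<bar>Cbar\<bar> + 1) * ?h ^ p * sobolev_norm \<Omega> (p + 1) c"
    proof (intro mult_right_mono sobolev_norm_nonneg zero_le_power)
      show "0 \<le> ?h"
        using assms(1) mesh by (intro mesh_size_nonneg) (simp_all add: bounded_domain_def)
    qed linarith
    finally show "energy_norm \<Omega> Dx Dy u v \<mu> (\<lambda>z. ch z - c z)
        \<le> ?C * ?h ^ p * sobolev_norm \<Omega> (p + 1) c"
      using M(1) by (simp add: mult.assoc)
  qed
qed

end
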